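(* Let $M$ be a $C^\infty$ manifold of dimension $n$, let $(x,U)$ be a coordinate chart of $M$, and let $\omega$ be a two-tensor on $M$ with local expression $\omega=\sum_{i,j=1}^n a_{ij}\,dx^i\otimes dx^j$ on $U$, where the $a_{ij}:U\to\mathbf{R}$ are $C^\infty$. Let $\gamma:I^2\to U$ be a $C^\infty$ immersion, where $I^2=\{(t_1,t_2)\in\mathbf{R}^2 \mid 0\le t_1\le 1,\ 0\le t_2\le 1\}$, and write $\gamma^i=x^i\circ\gamma$. A necessary condition for $J(\gamma)$ to be an extreme value with respect to variations (that is, for the function $s\mapsto J(\alpha(s))$ to have a local extremum at $s=0$ for every $C^\infty$ variation $\alpha$ of $\gamma$ fixing the boundary values) is that, for each $\ell=1,2,\ldots,n$ and all $(t_1,t_2)\in I^2$, $$\sum_{i,j=1}^n\Big(-\frac{\partial a_{ij}}{\partial x^\ell}+\frac{\partial a_{\ell j}}{\partial x^i}+\frac{\partial a_{i\ell}}{\partial x^j}\Big)(\gamma(t_1,t_2))\,\frac{\partial\gamma^i}{\partial t_1}\frac{\partial\gamma^j}{\partial t_2}+\sum_{j=1}^n(a_{\ell j}+a_{j\ell})(\gamma(t_1,t_2))\,\frac{\partial^2\gamma^j}{\partial t_1\,\partial t_2}=0,$$ where the partial derivatives of the $\gamma^i$ are evaluated at $(t_1,t_2)$.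
   Context: A two-tensor on $M$ is a $C^\infty$ section of $T^*(M)\otimes T^*(M)$ (no symmetry assumed). For the immersion $\gamma$, $$J(\gamma)=\int_0^1\int_0^1\omega\Big(\frac{\partial\gamma}{\partial t_1}\otimes\frac{\partial\gamma}{\partial t_2}\Big)\,dt_1\,dt_2 .$$ A $C^\infty$ variation of $\gamma$ is a $C^\infty$ map $\alpha:(-\epsilon,\epsilon)\times I^2\to U$ (with $\epsilon>0$) such that $\alpha(0,t_1,t_2)=\gamma(t_1,t_2)$ and, for all $-\epsilon<s<\epsilon$, $\alpha(s,1,t_2)=\gamma(1,t_2)$, $\alpha(s,0,t_2)=\gamma(0,t_2)$, $\alpha(s,t_1,1)=\gamma(t_1,1)$, $\alpha(s,t_1,0)=\gamma(t_1,0)$. For such $\alpha$, $$J(\alpha(s))=\int_0^1\int_0^1\omega\Big(\frac{\partial\alpha}{\partial t_1}(s,t_1,t_2)\otimes\frac{\partial\alpha}{\partial t_2}(s,t_1,t_2)\Big)\,dt_1\,dt_2 .$$ *)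

theory Defs
  imports "HOL-Analysis.Analysis"
begin

section \<open>Smooth maps between Euclidean spaces\<close>

primrec times_differentiable_on ::
    "nat \<Rightarrow> 'a::euclidean_space set \<Rightarrow> ('a \<Rightarrow> 'b::real_normed_vector) \<Rightarrow> bool" where
  "times_differentiable_on 0 W f \<longleftrightarrow> continuous_on W f"
| "times_differentiable_on (Suc k) W f \<longleftrightarrow>
     (\<forall>p\<in>W. f differentiable (at p)) \<and>
     (\<forall>v. times_differentiable_on k W (\<lambda>p. frechet_derivative f (at p) v))"

text \<open>\<open>S\<close> may be an arbitrary subset, such as a closed square:
  \<open>f\<close> is smooth on \<open>S\<close> if near each point of \<open>S\<close> it is the restriction of a \<open>C\<^sup>\<infinity>\<close> map defined on
  an open set. For open \<open>S\<close> this is the usual notion.\<close>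

definition smooth_on :: "'a::euclidean_space set \<Rightarrow> ('a \<Rightarrow> 'b::real_normed_vector) \<Rightarrow> bool" where
  "smooth_on S f \<longleftrightarrow>
     (\<forall>p\<in>S. \<exists>W g. open W \<and> p \<in> W \<and> (\<forall>k. times_differentiable_on k W g) \<and>
                   (\<forall>q\<in>S \<inter> W. f q = g q))"


section \<open>Smooth manifolds\<close>

text \<open>A chart \<open>(x, U)\<close> is represented by a total function \<open>x\<close>; its values outside \<open>U\<close> are irrelevant.\<close>

type_synonym ('m, 'n) chart = "('m \<Rightarrow> real ^ 'n) \<times> 'm set"

record ('m, 'n) manifold =
  mtop :: "'m topology"
  charts :: "('m, 'n) chart set"

definition topological_chart :: "'m topology \<Rightarrow> ('m, 'n::finite) chart \<Rightarrow> bool" where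
  "topological_chart X = (\<lambda>(x, U).
     openin X U \<and> open (x ` U) \<and>
     homeomorphic_map (subtopology X U) (top_of_set (x ` U)) x)"

definition compatible :: "('m, 'n::finite) chart \<Rightarrow> ('m, 'n) chart \<Rightarrow> bool" where
  "compatible = (\<lambda>(x, U) (y, V).
     smooth_on (x ` (U \<inter> V)) (y \<circ> inv_into U x) \<and>
     smooth_on (y ` (U \<inter> V)) (x \<circ> inv_into V y))"

definition smooth_manifold :: "('m, 'n::finite) manifold \<Rightarrow> bool" where
  "smooth_manifold M \<longleftrightarrow>
     Hausdorff_space (mtop M) \<and> second_countable (mtop M) \<and>
     (\<forall>c\<in>charts M. topological_chart (mtop M) c) \<and>
     topspace (mtop M) = (\<Union>(x, U)\<in>charts M. U) \<and>
     (\<forall>c\<in>charts M. \<forall>d\<in>charts M. compatible c d) \<and>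
     (\<forall>c. topological_chart (mtop M) c \<and> (\<forall>d\<in>charts M. compatible c d) \<longrightarrow> c \<in> charts M)"

text \<open>\<open>S\<close> is meant to be an open subset of the manifold.\<close>

definition smooth_fun_on ::
    "('m, 'n::finite) manifold \<Rightarrow> 'm set \<Rightarrow> ('m \<Rightarrow> real) \<Rightarrow> bool" where
  "smooth_fun_on M S f \<longleftrightarrow>
     (\<forall>(y, V)\<in>charts M. smooth_on (y ` (S \<inter> V)) (f \<circ> inv_into V y))"

definition smooth_near :: "('m, 'n::finite) manifold \<Rightarrow> 'm \<Rightarrow> ('m \<Rightarrow> real) \<Rightarrow> bool" where
  "smooth_near M p f \<longleftrightarrow> (\<exists>W. openin (mtop M) W \<and> p \<in> W \<and> smooth_fun_on M W f)"

definition smooth_map_into ::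
    "('m, 'n::finite) manifold \<Rightarrow> 'e::euclidean_space set \<Rightarrow> ('e \<Rightarrow> 'm) \<Rightarrow> bool" where
  "smooth_map_into M S g \<longleftrightarrow>
     (\<forall>p\<in>S. \<exists>(y, V)\<in>charts M. \<exists>W. open W \<and> p \<in> W \<and> g ` (S \<inter> W) \<subseteq> V \<and>
               smooth_on (S \<inter> W) (y \<circ> g))"


section \<open>Tangent vectors and two-tensors\<close>

text \<open>A tangent vector at \<open>p\<close> is a derivation of the algebra of germs at \<open>p\<close> of smooth functions.
  Germs are represented by total functions that are smooth near \<open>p\<close>; outside this class a
  derivation is put to \<open>0\<close>, so that a tangent vector is determined by its action on germs.\<close>

type_synonym 'm derivation = "('m \<Rightarrow> real) \<Rightarrow> real"

definition tangent_space :: "('m, 'n::finite) manifold \<Rightarrow> 'm \<Rightarrow> 'm derivation set" where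
  "tangent_space M p = {v.
     (\<forall>f g. smooth_near M p f \<and> smooth_near M p g \<longrightarrow>
        (\<forall>c d. v (\<lambda>q. c * f q + d * g q) = c * v f + d * v g) \<and>
        v (\<lambda>q. f q * g q) = v f * g p + f p * v g \<and>
        ((\<exists>W. openin (mtop M) W \<and> p \<in> W \<and> (\<forall>q\<in>W. f q = g q)) \<longrightarrow> v f = v g)) \<and>
     (\<forall>f. \<not> smooth_near M p f \<longrightarrow> v f = 0)}"

text \<open>The coordinate vector field \<open>\<partial>/\<partial>x\<^sup>l\<close> of a chart; thus
  \<open>coord_vec M (x, U) l p f\<close> is the partial derivative \<open>\<partial>f/\<partial>x\<^sup>l (p)\<close>.\<close>

definition coord_vec ::
    "('m, 'n::finite) manifold \<Rightarrow> ('m, 'n) chart \<Rightarrow> 'n \<Rightarrow> 'm \<Rightarrow> 'm derivation" where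
  "coord_vec M = (\<lambda>(x, U) l p f.
     if smooth_near M p f
     then frechet_derivative (f \<circ> inv_into U x) (at (x p)) (axis l 1) else 0)"

text \<open>The coordinate one-form \<open>dx\<^sup>i\<close>, acting on a tangent vector at a point of the chart domain.\<close>

definition coord_form :: "('m \<Rightarrow> real ^ 'n::finite) \<Rightarrow> 'n \<Rightarrow> 'm derivation \<Rightarrow> real" where
  "coord_form x i v = v (\<lambda>q. x q $ i)"

text \<open>Elements of \<open>T\<^sub>p\<^sup>*M \<otimes> T\<^sub>p\<^sup>*M\<close> are the bilinear forms on \<open>T\<^sub>pM\<close>, with
  \<open>\<omega> p v w\<close> for the value on \<open>v \<otimes> w\<close>. Smoothness of a section is smoothness of its
  components in all charts.\<close>

type_synonym 'm tensor2 = "'m \<Rightarrow> 'm derivation \<Rightarrow> 'm derivation \<Rightarrow> real"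

definition two_tensor :: "('m, 'n::finite) manifold \<Rightarrow> 'm tensor2 \<Rightarrow> bool" where
  "two_tensor M \<omega> \<longleftrightarrow>
     (\<forall>p\<in>topspace (mtop M).
        \<forall>u\<in>tangent_space M p. \<forall>v\<in>tangent_space M p. \<forall>w\<in>tangent_space M p. \<forall>c d.
          \<omega> p (\<lambda>f. c * u f + d * v f) w = c * \<omega> p u w + d * \<omega> p v w \<and>
          \<omega> p w (\<lambda>f. c * u f + d * v f) = c * \<omega> p w u + d * \<omega> p w v) \<and>
     (\<forall>(x, U)\<in>charts M. \<forall>i j.
        smooth_fun_on M U (\<lambda>p. \<omega> p (coord_vec M (x, U) i p) (coord_vec M (x, U) j p)))"

text \<open>The local expression \<open>\<omega> = \<Sum>i j. a\<^sub>i\<^sub>j dx\<^sup>i \<otimes> dx\<^sup>j\<close> on \<open>U\<close>.\<close>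

definition local_expression ::
    "('m, 'n::finite) manifold \<Rightarrow> ('m, 'n) chart \<Rightarrow> 'm tensor2 \<Rightarrow> ('n \<Rightarrow> 'n \<Rightarrow> 'm \<Rightarrow> real) \<Rightarrow> bool" where
  "local_expression M = (\<lambda>(x, U) \<omega> a.
     \<forall>p\<in>U. \<forall>v\<in>tangent_space M p. \<forall>w\<in>tangent_space M p.
       \<omega> p v w = (\<Sum>i\<in>UNIV. \<Sum>j\<in>UNIV. a i j p * (coord_form x i v * coord_form x j w)))"


section \<open>Immersed squares, the functional \<open>J\<close> and variations\<close>

definition I2 :: "(real \<times> real) set" where
  "I2 = {0..1} \<times> {0..1}"

text \<open>Partial derivatives on the square, one-sided at its edges.\<close>

definition pd1 :: "(real \<times> real \<Rightarrow> real) \<Rightarrow> real \<times> real \<Rightarrow> real" where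
  "pd1 h = (\<lambda>(t1, t2). vector_derivative (\<lambda>\<tau>. h (\<tau>, t2)) (at t1 within {0..1}))"

definition pd2 :: "(real \<times> real \<Rightarrow> real) \<Rightarrow> real \<times> real \<Rightarrow> real" where
  "pd2 h = (\<lambda>(t1, t2). vector_derivative (\<lambda>\<tau>. h (t1, \<tau>)) (at t2 within {0..1}))"

text \<open>The tangent vectors \<open>\<partial>\<gamma>/\<partial>t\<^sub>1\<close> and \<open>\<partial>\<gamma>/\<partial>t\<^sub>2\<close> at \<open>\<gamma> t\<close>.\<close>

definition velocity1 ::
    "('m, 'n::finite) manifold \<Rightarrow> (real \<times> real \<Rightarrow> 'm) \<Rightarrow> real \<times> real \<Rightarrow> 'm derivation" where
  "velocity1 M \<gamma> t = (\<lambda>f. if smooth_near M (\<gamma> t) f then pd1 (f \<circ> \<gamma>) t else 0)"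

definition velocity2 ::
    "('m, 'n::finite) manifold \<Rightarrow> (real \<times> real \<Rightarrow> 'm) \<Rightarrow> real \<times> real \<Rightarrow> 'm derivation" where
  "velocity2 M \<gamma> t = (\<lambda>f. if smooth_near M (\<gamma> t) f then pd2 (f \<circ> \<gamma>) t else 0)"

text \<open>The differential at \<open>t\<close> of a smooth map \<open>g\<close> on \<open>S\<close>. It is used for sets \<open>S\<close>, such as the
  square, on which derivatives relative to \<open>S\<close> are unique.\<close>

definition differential ::
    "('m, 'n::finite) manifold \<Rightarrow> 'e::euclidean_space set \<Rightarrow> ('e \<Rightarrow> 'm) \<Rightarrow> 'e \<Rightarrow> 'e \<Rightarrow> 'm derivation" where
  "differential M S g t v =
     (\<lambda>f. if smooth_near M (g t) f then frechet_derivative (f \<circ> g) (at t within S) v else 0)"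

definition immersion_of_square ::
    "('m, 'n::finite) manifold \<Rightarrow> (real \<times> real \<Rightarrow> 'm) \<Rightarrow> bool" where
  "immersion_of_square M \<gamma> \<longleftrightarrow>
     smooth_map_into M I2 \<gamma> \<and> (\<forall>t\<in>I2. inj (differential M I2 \<gamma> t))"

definition J :: "('m, 'n::finite) manifold \<Rightarrow> 'm tensor2 \<Rightarrow> (real \<times> real \<Rightarrow> 'm) \<Rightarrow> real" where
  "J M \<omega> \<gamma> =
     integral {0..1} (\<lambda>t2. integral {0..1} (\<lambda>t1.
       \<omega> (\<gamma> (t1, t2)) (velocity1 M \<gamma> (t1, t2)) (velocity2 M \<gamma> (t1, t2))))"

definition variation ::
    "('m, 'n::finite) manifold \<Rightarrow> 'm set \<Rightarrow> (real \<times> real \<Rightarrow> 'm) \<Rightarrow> real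
       \<Rightarrow> (real \<Rightarrow> real \<times> real \<Rightarrow> 'm) \<Rightarrow> bool" where
  "variation M U \<gamma> \<epsilon> \<alpha> \<longleftrightarrow>
     \<epsilon> > 0 \<and>
     smooth_map_into M ({-\<epsilon><..<\<epsilon>} \<times> I2) (\<lambda>(s, t). \<alpha> s t) \<and>
     (\<forall>s\<in>{-\<epsilon><..<\<epsilon>}. \<forall>t\<in>I2. \<alpha> s t \<in> U) \<and>
     (\<forall>t\<in>I2. \<alpha> 0 t = \<gamma> t) \<and>
     (\<forall>s\<in>{-\<epsilon><..<\<epsilon>}. \<forall>\<tau>\<in>{0..1}.
        \<alpha> s (1, \<tau>) = \<gamma> (1, \<tau>) \<and> \<alpha> s (0, \<tau>) = \<gamma> (0, \<tau>) \<and>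
        \<alpha> s (\<tau>, 1) = \<gamma> (\<tau>, 1) \<and> \<alpha> s (\<tau>, 0) = \<gamma> (\<tau>, 0))"

definition local_extremum :: "(real \<Rightarrow> real) \<Rightarrow> real \<Rightarrow> bool" where
  "local_extremum F s0 \<longleftrightarrow>
     (\<forall>\<^sub>F s in nhds s0. F s \<le> F s0) \<or> (\<forall>\<^sub>F s in nhds s0. F s \<ge> F s0)"

end

theory Submission
  imports Defs
begin

text \<open>In the chart, the square is a smooth map \<open>c = x \<circ> \<gamma>\<close> into an open set of \<open>\<real>\<^sup>n\<close>, and \<open>J\<close> is the
  integral of \<open>\<Sum>i j. A\<^sub>i\<^sub>j(c) \<partial>\<^sub>1c\<^sup>i \<partial>\<^sub>2c\<^sup>j\<close>, where \<open>A\<^sub>i\<^sub>j\<close> represents \<open>a\<^sub>i\<^sub>j\<close>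
  (\<open>J_eq_integral_lagrangian\<close>). Moving \<open>c\<close> in the direction of the \<open>l\<close>-th axis, to \<open>c + s \<phi> e\<^sub>l\<close>
  with \<open>\<phi> = 0\<close> on the edges, gives for small \<open>s\<close> an admissible variation of \<open>\<gamma>\<close>. The derivative of
  \<open>J\<close> at \<open>s = 0\<close> is \<open>- \<integral> \<phi> E\<^sub>l\<close>, by differentiation under the integral sign and integration by parts
  (\<open>first_variation\<close>), where \<open>E\<^sub>l\<close> is the Euler expression \<open>euler l\<close>. Expanded by the chain rule,
  \<open>E\<^sub>l\<close> is the left-hand side of the claimed equation (\<open>euler_eq\<close>).

  At a local extremum the derivative is zero. The expression \<open>E\<^sub>l\<close> is itself smooth on the closed square, so
  the choice \<open>\<phi> = w E\<^sub>l\<close> with \<open>w = t\<^sub>1 (1 - t\<^sub>1) t\<^sub>2 (1 - t\<^sub>2)\<close> is allowed, and \<open>\<integral> w E\<^sub>l\<^sup>2 = 0\<close> forces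
  \<open>E\<^sub>l = 0\<close> (\<open>extremal_imp_euler_zero\<close>).

  Two points need care. Smoothness on the closed square means local extendability, so derivatives at the
  edges are one-sided and all rules of calculus have to hold up to the edges; they are obtained from the
  extensions (\<open>smooth_extension_line\<close>). And the tensor is evaluated on abstract tangent vectors, so the
  velocities of a smooth square must be shown to be derivations of germs
  (\<open>velocity1_tangent\<close>, \<open>velocity2_tangent\<close>).\<close>

section \<open>Functions of class \<open>C\<^sup>k\<close> on open sets\<close>

lemma times_differentiable_on_subset:
  "times_differentiable_on k W f \<Longrightarrow> V \<subseteq> W \<Longrightarrow> times_differentiable_on k V f"
  by (induction k arbitrary: f) (auto intro: continuous_on_subset)

lemma times_differentiable_on_SucD:
  "times_differentiable_on (Suc k) W f \<Longrightarrow> times_differentiable_on k W f"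
proof (induction k arbitrary: f)
  case 0
  then show ?case
    by (auto intro!: differentiable_imp_continuous_on differentiable_at_imp_differentiable_on)
next
  case (Suc k)
  then show ?case by (metis times_differentiable_on.simps(2))
qed

lemma times_differentiable_on_cong:
  assumes "open W" "\<And>p. p \<in> W \<Longrightarrow> f p = g p" "times_differentiable_on k W f"
  shows "times_differentiable_on k W g"
  using assms(2,3)
proof (induction k arbitrary: f g)
  case 0
  then show ?case using continuous_on_cong by fastforce
next
  case (Suc k)
  have *: "(g has_derivative frechet_derivative f (at p)) (at p)" if "p \<in> W" for p
  proof (rule has_derivative_transform_within_open[OF _ assms(1) that])
    show "(f has_derivative frechet_derivative f (at p)) (at p)"
      using Suc.prems(2) that by (simp add: frechet_derivative_works)
  qed (rule Suc.prems(1))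
  then have "g differentiable (at p)" if "p \<in> W" for p
    using that differentiable_def by blast
  moreover have "frechet_derivative f (at p) = frechet_derivative g (at p)" if "p \<in> W" for p
    using *[OF that] by (rule frechet_derivative_at)
  then have "times_differentiable_on k W (\<lambda>p. frechet_derivative g (at p) v)" for v
    using Suc.prems(2) by - (rule Suc.IH[of "\<lambda>p. frechet_derivative f (at p) v"]; simp)
  ultimately show ?case by simp
qed

text \<open>The form in which a rule of differentiation is used below: the derivative \<open>D\<close> that the rule provides
  stands for \<^const>\<open>frechet_derivative\<close>, which on an open set is the only one.\<close>

lemma times_differentiable_on_SucI:
  assumes "open W" "\<And>p. p \<in> W \<Longrightarrow> (f has_derivative D p) (at p)"
    "\<And>v. times_differentiable_on k W (\<lambda>p. D p v)"
  shows "times_differentiable_on (Suc k) W f"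
proof -
  have "D p = frechet_derivative f (at p)" if "p \<in> W" for p
    using assms(2)[OF that] by (rule frechet_derivative_at)
  then have "times_differentiable_on k W (\<lambda>p. frechet_derivative f (at p) v)" for v
    using assms by (intro times_differentiable_on_cong[OF assms(1) _ assms(3)[of v]]) auto
  then show ?thesis using assms(2) by (auto simp: differentiable_def)
qed

lemma times_differentiable_on_Suc_has_derivative:
  "times_differentiable_on (Suc k) W f \<Longrightarrow> p \<in> W \<Longrightarrow>
     (f has_derivative frechet_derivative f (at p)) (at p)"
  by (simp add: frechet_derivative_works)

lemma times_differentiable_on_const: "times_differentiable_on k W (\<lambda>p. c)"
  by (induction k arbitrary: c) auto

lemma times_differentiable_on_bounded_linear:
  assumes "open W" "bounded_linear L"
  shows "times_differentiable_on k W L"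
proof (cases k)
  case 0
  then show ?thesis using assms(2) by (simp add: linear_continuous_on)
next
  case (Suc k')
  then show ?thesis
    using assms by (auto intro!: times_differentiable_on_SucI[of _ _ "\<lambda>p. L"]
      bounded_linear_imp_has_derivative times_differentiable_on_const simp del: times_differentiable_on.simps)
qed

lemma times_differentiable_on_add:
  assumes "open W"
  shows "times_differentiable_on k W f \<Longrightarrow> times_differentiable_on k W g
    \<Longrightarrow> times_differentiable_on k W (\<lambda>p. f p + g p)"
proof (induction k arbitrary: f g)
  case 0
  then show ?case by (auto intro: continuous_on_add)
next
  case (Suc k)
  show ?case
    by (rule times_differentiable_on_SucI[OF assms has_derivative_add])
       (use Suc in \<open>auto intro!: Suc.IH simp: frechet_derivative_works\<close>)
qed

lemma times_differentiable_on_sum: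
  assumes "open W"
  shows "finite A \<Longrightarrow> (\<And>i. i \<in> A \<Longrightarrow> times_differentiable_on k W (f i))
    \<Longrightarrow> times_differentiable_on k W (\<lambda>p. \<Sum>i\<in>A. f i p)"
  by (induction A rule: finite_induct)
     (auto intro!: times_differentiable_on_add[OF assms] times_differentiable_on_const)

text \<open>The derivative of \<open>B f g\<close> is a sum of two expressions of the same kind, each with one factor
  differentiated once; so the induction on the order has to quantify over both factors.\<close>

lemma times_differentiable_on_bilinear:
  assumes "open W" "bounded_bilinear B"
  shows "times_differentiable_on k W f \<Longrightarrow> times_differentiable_on k W g
    \<Longrightarrow> times_differentiable_on k W (\<lambda>p. B (f p) (g p))"
proof (induction k arbitrary: f g)
  case 0
  then show ?case using bounded_bilinear.continuous_on[OF assms(2)] by auto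
next
  case (Suc k)
  show ?case
    by (rule times_differentiable_on_SucI[OF assms(1) bounded_bilinear.FDERIV[OF assms(2)
          times_differentiable_on_Suc_has_derivative[OF Suc.prems(1)]
          times_differentiable_on_Suc_has_derivative[OF Suc.prems(2)]]])
       (use Suc.prems times_differentiable_on_SucD[OF Suc.prems(1)] times_differentiable_on_SucD[OF Suc.prems(2)]
        in \<open>auto intro!: times_differentiable_on_add[OF assms(1)] Suc.IH\<close>)
qed

text \<open>In the chain rule the derivative of \<open>g\<close> is applied to a vector that depends on the point. Expanding this
  vector in the basis turns the derivative of the composition into a finite sum of products of scalar
  functions with compositions \<open>(\<partial>\<^sub>b g) \<circ> f\<close>, and these are covered by the induction hypothesis.\<close>

lemma times_differentiable_on_compose:
  fixes f :: "'a::euclidean_space \<Rightarrow> 'b::euclidean_space"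
  assumes "open V" "open W"
  shows "times_differentiable_on k V g \<Longrightarrow> times_differentiable_on k W f \<Longrightarrow> f ` W \<subseteq> V
    \<Longrightarrow> times_differentiable_on k W (\<lambda>p. g (f p))"
proof (induction k arbitrary: f g)
  case 0
  then show ?case by (auto intro: continuous_on_compose2)
next
  case (Suc k)
  let ?D = "\<lambda>p v. \<Sum>b\<in>Basis. (frechet_derivative f (at p) v \<bullet> b) *\<^sub>R frechet_derivative g (at (f p)) b"
  show ?case
  proof (rule times_differentiable_on_SucI[OF assms(2)])
    fix p assume p: "p \<in> W"
    then have g: "(g has_derivative frechet_derivative g (at (f p))) (at (f p))"
      and f: "(f has_derivative frechet_derivative f (at p)) (at p)"
      using Suc.prems by (auto intro!: times_differentiable_on_Suc_has_derivative)
    have "frechet_derivative g (at (f p)) (frechet_derivative f (at p) v) = ?D p v" for v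
    proof -
      have lin: "linear (frechet_derivative g (at (f p)))"
        using g has_derivative_linear by blast
      have "frechet_derivative g (at (f p)) (\<Sum>b\<in>Basis. (frechet_derivative f (at p) v \<bullet> b) *\<^sub>R b)
        = ?D p v"
        by (simp add: linear_sum[OF lin] linear_cmul[OF lin] del: euclidean_representation)
      then show ?thesis by (simp add: euclidean_representation)
    qed
    then show "((\<lambda>p. g (f p)) has_derivative ?D p) (at p)"
      using has_derivative_compose[OF f g] by simp
  next
    fix v
    have "times_differentiable_on k W (\<lambda>p. frechet_derivative g (at (f p)) b)" for b
      using Suc.prems times_differentiable_on_SucD[OF Suc.prems(2)]
      by - (rule Suc.IH[of "\<lambda>q. frechet_derivative g (at q) b"]; simp)
    moreover have "times_differentiable_on k W (\<lambda>p. frechet_derivative f (at p) v \<bullet> b)" for b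
      using Suc.prems(2)
      by (intro times_differentiable_on_bilinear[OF assms(2) bounded_bilinear_inner]
          times_differentiable_on_const) auto
    ultimately show "times_differentiable_on k W (\<lambda>p. ?D p v)"
      by (intro times_differentiable_on_sum[OF assms(2)]
          times_differentiable_on_bilinear[OF assms(2) bounded_bilinear_scaleR]) auto
  qed
qed

section \<open>Smooth functions on arbitrary sets\<close>

text \<open>The local witness in the definition of \<^const>\<open>smooth_on\<close>. It has a name because all derivatives relative to
  \<open>S\<close> are computed from such a \<open>g\<close>.\<close>

definition smooth_extension ::
    "'a::euclidean_space set \<Rightarrow> ('a \<Rightarrow> 'b::real_normed_vector) \<Rightarrow> 'a set \<Rightarrow> ('a \<Rightarrow> 'b) \<Rightarrow> bool" where
  "smooth_extension S f W g \<longleftrightarrow>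
     open W \<and> (\<forall>k. times_differentiable_on k W g) \<and> (\<forall>q\<in>S \<inter> W. f q = g q)"

lemma smooth_on_iff_extension:
  "smooth_on S f \<longleftrightarrow> (\<forall>p\<in>S. \<exists>W g. p \<in> W \<and> smooth_extension S f W g)"
  unfolding smooth_on_def smooth_extension_def by blast

lemma smooth_onE:
  assumes "smooth_on S f" "p \<in> S"
  obtains W g where "p \<in> W" "smooth_extension S f W g"
  using assms unfolding smooth_on_iff_extension by blast

lemma smooth_extension_differentiable:
  "smooth_extension S f W g \<Longrightarrow> q \<in> W \<Longrightarrow> (g has_derivative frechet_derivative g (at q)) (at q)"
  unfolding smooth_extension_def by (blast intro: times_differentiable_on_Suc_has_derivative)

lemma smooth_extension_derivative:
  assumes "smooth_extension S f W g"
  shows "times_differentiable_on k W (\<lambda>q. frechet_derivative g (at q) v)"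
proof -
  have "times_differentiable_on (Suc k) W g" using assms unfolding smooth_extension_def by blast
  then show ?thesis by simp
qed

lemma smooth_on_cong_subset:
  assumes "smooth_on S f" "T \<subseteq> S" "\<And>p. p \<in> T \<Longrightarrow> f p = g p"
  shows "smooth_on T g"
  unfolding smooth_on_iff_extension
proof
  fix p assume "p \<in> T"
  then obtain W h where W: "p \<in> W" "smooth_extension S f W h" using smooth_onE[OF assms(1)] assms(2) by blast
  then have "smooth_extension T g W h" using assms(2) assms(3)[symmetric] unfolding smooth_extension_def by auto
  with W show "\<exists>W h. p \<in> W \<and> smooth_extension T g W h" by blast
qed

lemmas smooth_on_cong = smooth_on_cong_subset[OF _ subset_refl]

lemma smooth_on_subset: "smooth_on S f \<Longrightarrow> T \<subseteq> S \<Longrightarrow> smooth_on T f"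
  by (rule smooth_on_cong_subset) auto

lemma smooth_on_local:
  assumes "\<And>p. p \<in> S \<Longrightarrow> \<exists>W. open W \<and> p \<in> W \<and> smooth_on (S \<inter> W) f"
  shows "smooth_on S f"
  unfolding smooth_on_iff_extension
proof
  fix p assume p: "p \<in> S"
  then obtain W where W: "open W" "p \<in> W" "smooth_on (S \<inter> W) f" using assms by blast
  then obtain V g where V: "p \<in> V" "smooth_extension (S \<inter> W) f V g"
    using p by (meson IntI smooth_onE)
  have "smooth_extension S f (V \<inter> W) g"
    using V(2) W(1) times_differentiable_on_subset[of _ V g "V \<inter> W"]
    unfolding smooth_extension_def by auto
  then show "\<exists>W g. p \<in> W \<and> smooth_extension S f W g" using V W by blast
qed

lemma smooth_on_const: "smooth_on S (\<lambda>p. c)"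
  unfolding smooth_on_def by (auto intro!: times_differentiable_on_const exI[of _ UNIV] exI[of _ "\<lambda>p. c"])

lemma smooth_on_bounded_linear: "bounded_linear L \<Longrightarrow> smooth_on S L"
  unfolding smooth_on_def using times_differentiable_on_bounded_linear[OF open_UNIV] by blast

lemma smooth_on_bilinear:
  assumes "bounded_bilinear B" "smooth_on S f" "smooth_on S g"
  shows "smooth_on S (\<lambda>p. B (f p) (g p))"
  unfolding smooth_on_iff_extension
proof
  fix p assume p: "p \<in> S"
  obtain W f' where W: "p \<in> W" "smooth_extension S f W f'" by (rule smooth_onE[OF assms(2) p])
  obtain V g' where V: "p \<in> V" "smooth_extension S g V g'" by (rule smooth_onE[OF assms(3) p])
  have "smooth_extension S (\<lambda>p. B (f p) (g p)) (W \<inter> V) (\<lambda>p. B (f' p) (g' p))"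
    using V W times_differentiable_on_subset[of _ V g' "W \<inter> V"] times_differentiable_on_subset[of _ W f' "W \<inter> V"]
    unfolding smooth_extension_def
    by (auto intro!: times_differentiable_on_bilinear[OF _ assms(1)])
  then show "\<exists>W h. p \<in> W \<and> smooth_extension S (\<lambda>p. B (f p) (g p)) W h" using V W by blast
qed

lemma smooth_on_compose:
  fixes f :: "'a::euclidean_space \<Rightarrow> 'b::euclidean_space"
  assumes "smooth_on T g" "smooth_on S f" "f ` S \<subseteq> T"
  shows "smooth_on S (\<lambda>p. g (f p))"
  unfolding smooth_on_iff_extension
proof
  fix p assume p: "p \<in> S"
  obtain W f' where W: "p \<in> W" "smooth_extension S f W f'" by (rule smooth_onE[OF assms(2) p])
  obtain V g' where V: "f p \<in> V" "smooth_extension T g V g'" using smooth_onE[OF assms(1)] assms(3) p by blast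
  define X where "X = W \<inter> f' -` V"
  have "continuous_on W f'" using W(2) unfolding smooth_extension_def
    using times_differentiable_on.simps(1) by blast
  then have X: "open X" using V(2) W(2) unfolding X_def smooth_extension_def
    by (blast intro: continuous_open_preimage)
  have "f p = f' p" using W p unfolding smooth_extension_def by blast
  then have pX: "p \<in> X" using W(1) V(1) by (simp add: X_def)
  have "smooth_extension S (\<lambda>p. g (f p)) X (\<lambda>p. g' (f' p))"
    unfolding smooth_extension_def
  proof (intro conjI X allI ballI)
    fix k show "times_differentiable_on k X (\<lambda>p. g' (f' p))"
      by (rule times_differentiable_on_compose[of V])
         (use V(2) W(2) X in \<open>auto simp: smooth_extension_def X_def intro: times_differentiable_on_subset\<close>)
  next
    fix q assume "q \<in> S \<inter> X"
    then show "g (f q) = g' (f' q)" using V(2) W(2) assms(3) unfolding smooth_extension_def X_def by auto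
  qed
  then show "\<exists>W h. p \<in> W \<and> smooth_extension S (\<lambda>p. g (f p)) W h" using pX by blast
qed

lemma smooth_on_linear_compose:
  fixes f :: "'a::euclidean_space \<Rightarrow> 'b::euclidean_space"
  shows "bounded_linear L \<Longrightarrow> smooth_on S f \<Longrightarrow> smooth_on S (\<lambda>p. L (f p))"
  by (rule smooth_on_compose[OF smooth_on_bounded_linear[of L UNIV]]) auto

lemmas smooth_on_mult = smooth_on_bilinear[OF bounded_bilinear_mult]
lemmas smooth_on_scaleR = smooth_on_bilinear[OF bounded_bilinear_scaleR]
lemmas smooth_on_vec_nth = smooth_on_linear_compose[OF bounded_linear_vec_nth]
lemmas smooth_on_fst = smooth_on_bounded_linear[OF bounded_linear_fst]
lemmas smooth_on_snd = smooth_on_bounded_linear[OF bounded_linear_snd]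

lemma smooth_on_add:
  assumes "smooth_on S f" "smooth_on S g"
  shows "smooth_on S (\<lambda>p. f p + g p)"
  unfolding smooth_on_iff_extension
proof
  fix p assume p: "p \<in> S"
  obtain W f' where W: "p \<in> W" "smooth_extension S f W f'" by (rule smooth_onE[OF assms(1) p])
  obtain V g' where V: "p \<in> V" "smooth_extension S g V g'" by (rule smooth_onE[OF assms(2) p])
  have "smooth_extension S (\<lambda>p. f p + g p) (W \<inter> V) (\<lambda>p. f' p + g' p)"
    using V W times_differentiable_on_subset[of _ V g' "W \<inter> V"] times_differentiable_on_subset[of _ W f' "W \<inter> V"]
    unfolding smooth_extension_def
    by (auto intro!: times_differentiable_on_add)
  then show "\<exists>W h. p \<in> W \<and> smooth_extension S (\<lambda>p. f p + g p) W h" using V W by blast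
qed

lemma smooth_on_diff:
  fixes f g :: "'a::euclidean_space \<Rightarrow> real"
  assumes "smooth_on S f" "smooth_on S g"
  shows "smooth_on S (\<lambda>p. f p - g p)"
  using smooth_on_add[OF assms(1) smooth_on_mult[OF smooth_on_const[of S "-1"] assms(2)]] by simp

lemma smooth_on_sum:
  "finite A \<Longrightarrow> (\<And>i. i \<in> A \<Longrightarrow> smooth_on S (f i)) \<Longrightarrow> smooth_on S (\<lambda>p. \<Sum>i\<in>A. f i p)"
  by (induction A rule: finite_induct) (auto intro!: smooth_on_add smooth_on_const)

lemma smooth_on_imp_continuous_on: "smooth_on S f \<Longrightarrow> continuous_on S f"
  unfolding continuous_on_eq_continuous_within
proof
  fix p assume "smooth_on S f" "p \<in> S"
  then obtain W g where W: "p \<in> W" "smooth_extension S f W g" by (rule smooth_onE)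
  then have g: "isCont g p" using smooth_extension_differentiable has_derivative_continuous by blast
  have ev: "\<forall>\<^sub>F q in at p within S. g q = f q"
    using W unfolding smooth_extension_def eventually_at_topological by force
  have "(g \<longlongrightarrow> g p) (at p within S)"
    using continuous_at_imp_continuous_at_within[OF g, of S] by (simp add: continuous_within)
  moreover have "g p = f p" using W \<open>p \<in> S\<close> unfolding smooth_extension_def by auto
  ultimately show "continuous (at p within S) f"
    using Lim_transform_eventually[OF _ ev] by (simp add: continuous_within)
qed

text \<open>A curve that stays in \<open>S\<close> cannot distinguish \<open>f\<close> from its extension. This gives the one-sided
  derivatives at the edges of the square, and shows that they do not depend on the extension.\<close>

lemma smooth_extension_line:
  assumes ext: "smooth_extension S f W g" and l: "(l has_vector_derivative v) (at \<tau> within T)"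
    and "\<tau> \<in> T" "l ` T \<subseteq> S" "l \<tau> \<in> W"
  shows "((\<lambda>u. f (l u)) has_vector_derivative frechet_derivative g (at (l \<tau>)) v) (at \<tau> within T)"
proof -
  have "((\<lambda>u. g (l u)) has_vector_derivative frechet_derivative g (at (l \<tau>)) v) (at \<tau> within T)"
    using vector_derivative_diff_chain_within[OF l has_derivative_at_withinI[OF smooth_extension_differentiable[OF ext assms(5)]]]
    by (simp add: o_def)
  moreover have "\<forall>\<^sub>F u in at \<tau> within T. g (l u) = f (l u)"
  proof -
    have "(l \<longlongrightarrow> l \<tau>) (at \<tau> within T)"
      using has_vector_derivative_continuous[OF l] by (simp add: continuous_within)
    then have "\<forall>\<^sub>F u in at \<tau> within T. l u \<in> W"
      using ext assms(5) unfolding smooth_extension_def by (intro topological_tendstoD) auto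
    moreover have "\<forall>\<^sub>F u in at \<tau> within T. u \<in> T" by (simp add: eventually_at_topological) blast
    ultimately show ?thesis
      by eventually_elim (use ext assms(4) in \<open>auto simp: smooth_extension_def\<close>)
  qed
  ultimately show ?thesis
    using assms unfolding smooth_extension_def has_vector_derivative_def
    by (elim has_derivative_transform_eventually) auto
qed

section \<open>Calculus on the closed unit square\<close>

lemma mem_I2: "(u, v) \<in> I2 \<longleftrightarrow> u \<in> {0..1} \<and> v \<in> {0..1}"
  by (simp add: I2_def)

lemma I2_cbox: "I2 = cbox (0, 0) (1, 1)"
  by (auto simp: I2_def cbox_Pair_eq)

lemma pd1_eq:
  assumes "((\<lambda>\<tau>. h (\<tau>, v)) has_real_derivative d) (at u within {0..1})" "u \<in> {0..1}"
  shows "pd1 h (u, v) = d"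
  using assms vector_derivative_within_closed_interval[of 0 1 u "\<lambda>\<tau>. h (\<tau>, v)" d]
  by (simp add: pd1_def has_real_derivative_iff_has_vector_derivative)

lemma pd2_eq:
  assumes "((\<lambda>\<tau>. h (u, \<tau>)) has_real_derivative d) (at v within {0..1})" "v \<in> {0..1}"
  shows "pd2 h (u, v) = d"
  using assms vector_derivative_within_closed_interval[of 0 1 v "\<lambda>\<tau>. h (u, \<tau>)" d]
  by (simp add: pd2_def has_real_derivative_iff_has_vector_derivative)

lemma horizontal_line: "((\<lambda>\<tau>. (\<tau>, v)) has_vector_derivative (1, 0)) (at u within T)"
  by (auto simp: has_vector_derivative_def intro!: derivative_eq_intros)

lemma vertical_line: "((\<lambda>\<tau>. (u, \<tau>)) has_vector_derivative (0, 1)) (at v within T)"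
  by (auto simp: has_vector_derivative_def intro!: derivative_eq_intros)

lemma smooth_extension_pd1:
  assumes "smooth_extension I2 h W g" "(u, v) \<in> W" "(u, v) \<in> I2"
  shows "((\<lambda>\<tau>. h (\<tau>, v)) has_real_derivative frechet_derivative g (at (u, v)) (1, 0)) (at u within {0..1})"
  using smooth_extension_line[OF assms(1) horizontal_line[of v u "{0..1}"]] assms
  by (auto simp: has_real_derivative_iff_has_vector_derivative mem_I2 image_subset_iff)

lemma smooth_extension_pd2:
  assumes "smooth_extension I2 h W g" "(u, v) \<in> W" "(u, v) \<in> I2"
  shows "((\<lambda>\<tau>. h (u, \<tau>)) has_real_derivative frechet_derivative g (at (u, v)) (0, 1)) (at v within {0..1})"
  using smooth_extension_line[OF assms(1) vertical_line[of u v "{0..1}"]] assms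
  by (auto simp: has_real_derivative_iff_has_vector_derivative mem_I2 image_subset_iff)

lemma has_pd1:
  assumes "smooth_on I2 h" "(u, v) \<in> I2"
  shows "((\<lambda>\<tau>. h (\<tau>, v)) has_real_derivative pd1 h (u, v)) (at u within {0..1})"
proof -
  obtain W g where W: "(u, v) \<in> W" "smooth_extension I2 h W g" by (rule smooth_onE[OF assms])
  show ?thesis using smooth_extension_pd1[OF W(2,1) assms(2)] pd1_eq[of h v _ u] assms(2) mem_I2 by force
qed

lemma has_pd2:
  assumes "smooth_on I2 h" "(u, v) \<in> I2"
  shows "((\<lambda>\<tau>. h (u, \<tau>)) has_real_derivative pd2 h (u, v)) (at v within {0..1})"
proof -
  obtain W g where W: "(u, v) \<in> W" "smooth_extension I2 h W g" by (rule smooth_onE[OF assms])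
  show ?thesis using smooth_extension_pd2[OF W(2,1) assms(2)] pd2_eq[of h u _ v] assms(2) mem_I2 by force
qed

text \<open>If every local extension \<open>g\<close> computes \<open>D\<close> as its derivative in the direction \<open>v\<close>, then
  the directional derivatives of the extensions are themselves local extensions of \<open>D\<close>.\<close>

lemma smooth_on_partial:
  assumes "smooth_on S h"
    and "\<And>W g q. smooth_extension S h W g \<Longrightarrow> q \<in> S \<Longrightarrow> q \<in> W \<Longrightarrow> D q = frechet_derivative g (at q) v"
  shows "smooth_on S D"
  unfolding smooth_on_iff_extension
proof
  fix p assume p: "p \<in> S"
  obtain W g where W: "p \<in> W" "smooth_extension S h W g" by (rule smooth_onE[OF assms(1) p])
  have "smooth_extension S D W (\<lambda>q. frechet_derivative g (at q) v)"
    unfolding smooth_extension_def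
  proof (intro conjI allI ballI)
    show "open W" using W(2) by (simp add: smooth_extension_def)
    show "times_differentiable_on k W (\<lambda>q. frechet_derivative g (at q) v)" for k
      by (rule smooth_extension_derivative[OF W(2)])
    show "D q = frechet_derivative g (at q) v" if "q \<in> S \<inter> W" for q
      using assms(2)[OF W(2)] that by blast
  qed
  then show "\<exists>W g. p \<in> W \<and> smooth_extension S D W g" using W(1) by blast
qed

lemma smooth_on_pd1:
  assumes "smooth_on I2 h"
  shows "smooth_on I2 (pd1 h)"
proof (rule smooth_on_partial[OF assms, where v="(1, 0)"])
  fix W g and q :: "real \<times> real"
  assume "smooth_extension I2 h W g" "q \<in> I2" "q \<in> W"
  then show "pd1 h q = frechet_derivative g (at q) (1, 0)"
    using pd1_eq[OF smooth_extension_pd1[of h W g "fst q" "snd q"]] by (cases q) (auto simp: mem_I2)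
qed

lemma smooth_on_pd2:
  assumes "smooth_on I2 h"
  shows "smooth_on I2 (pd2 h)"
proof (rule smooth_on_partial[OF assms, where v="(0, 1)"])
  fix W g and q :: "real \<times> real"
  assume "smooth_extension I2 h W g" "q \<in> I2" "q \<in> W"
  then show "pd2 h q = frechet_derivative g (at q) (0, 1)"
    using pd2_eq[OF smooth_extension_pd2[of h W g "fst q" "snd q"]] by (cases q) (auto simp: mem_I2)
qed

lemma smooth_on_slice_derivative:
  fixes f :: "real \<times> 'a::euclidean_space \<Rightarrow> real"
  assumes "smooth_on (T \<times> S) f" "open T"
  shows "smooth_on (T \<times> S) (\<lambda>(s, t). deriv (\<lambda>s. f (s, t)) s)"
    and "s \<in> T \<Longrightarrow> t \<in> S \<Longrightarrow> ((\<lambda>s. f (s, t)) has_real_derivative deriv (\<lambda>s. f (s, t)) s) (at s)"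
proof -
  have *: "((\<lambda>s. f (s, t)) has_real_derivative frechet_derivative g (at (s, t)) (1, 0)) (at s)"
    if "smooth_extension (T \<times> S) f W g" "s \<in> T" "t \<in> S" "(s, t) \<in> W" for W g s t
  proof -
    have "((\<lambda>s. (s, t)) has_vector_derivative (1, 0)) (at s within T)"
      by (auto simp: has_vector_derivative_def intro!: derivative_eq_intros)
    from smooth_extension_line[OF that(1) this that(2) _ that(4)] show ?thesis
      using that assms(2) by (auto simp: has_real_derivative_iff_has_vector_derivative at_within_open[of s T])
  qed
  show "smooth_on (T \<times> S) (\<lambda>(s, t). deriv (\<lambda>s. f (s, t)) s)"
    by (rule smooth_on_partial[OF assms(1), where v="(1, 0)"]) (auto intro!: DERIV_imp_deriv *)
  show "((\<lambda>s. f (s, t)) has_real_derivative deriv (\<lambda>s. f (s, t)) s) (at s)" if "s \<in> T" "t \<in> S"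
    using that smooth_onE[OF assms(1), of "(s, t)"] * DERIV_imp_deriv by (metis SigmaI)
qed

text \<open>The second derivatives commute up to the edges: in
  \<open>h (a, b) - h (0, b) = \<integral>\<^sub>0\<^sup>a pd1 h (\<tau>, b) d\<tau>\<close> differentiate first with respect to \<open>b\<close>, under the
  integral sign, and then with respect to \<open>a\<close>.\<close>

lemma mixed_partials_commute:
  assumes h: "smooth_on I2 h" and "t \<in> I2"
  shows "pd1 (pd2 h) t = pd2 (pd1 h) t"
proof -
  obtain u v where t: "t = (u, v)" "u \<in> {0..1}" "v \<in> {0..1}" using assms(2) mem_I2 by (cases t) auto
  have cont: "continuous_on I2 (pd2 (pd1 h))"
    by (intro smooth_on_imp_continuous_on smooth_on_pd1 smooth_on_pd2 h)
  have cont1: "continuous_on I2 (pd1 h)"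
    by (intro smooth_on_imp_continuous_on smooth_on_pd1 h)
  have *: "pd2 h (a, v) = pd2 h (0, v) + integral {0..a} (\<lambda>\<tau>. pd2 (pd1 h) (\<tau>, v))"
    if a: "a \<in> {0..1}" for a
  proof -
    have int: "((\<lambda>\<tau>. pd1 h (\<tau>, b)) has_integral h (a, b) - h (0, b)) {0..a}" if "b \<in> {0..1}" for b
      using a that
      by (intro fundamental_theorem_of_calculus
          DERIV_subset[OF has_pd1[OF h], unfolded has_real_derivative_iff_has_vector_derivative])
         (auto simp: mem_I2)
    have "((\<lambda>b. integral (cbox 0 a) (\<lambda>\<tau>. pd1 h (\<tau>, b))) has_field_derivative
        integral (cbox 0 a) (\<lambda>\<tau>. pd2 (pd1 h) (\<tau>, v))) (at v within {0..1})"
    proof (rule leibniz_rule_field_derivative)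
      show "((\<lambda>b. pd1 h (\<tau>, b)) has_field_derivative pd2 (pd1 h) (\<tau>, b)) (at b within {0..1})"
        if "b \<in> {0..1}" "\<tau> \<in> cbox 0 a" for b \<tau>
        using that a by (intro has_pd2 smooth_on_pd1 h) (auto simp: mem_I2)
      show "(\<lambda>\<tau>. pd1 h (\<tau>, b)) integrable_on cbox 0 a" if "b \<in> {0..1}" for b
        using int[OF that] by (auto simp: integrable_on_def)
      have "continuous_on ({0..1} \<times> cbox 0 a) (\<lambda>p. pd2 (pd1 h) (snd p, fst p))"
        using a by (intro continuous_on_compose2[OF cont] continuous_intros) (auto simp: mem_I2)
      then show "continuous_on ({0..1} \<times> cbox 0 a) (\<lambda>(b, \<tau>). pd2 (pd1 h) (\<tau>, b))"
        by (simp add: case_prod_beta)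
    qed (use t in auto)
    moreover have 0: "integral (cbox 0 a) (\<lambda>\<tau>. pd1 h (\<tau>, b)) = h (a, b) - h (0, b)" if "b \<in> {0..1}" for b
      using int[OF that] by (simp add: integral_unique)
    ultimately have 1: "((\<lambda>b. h (a, b) - h (0, b)) has_field_derivative
        integral (cbox 0 a) (\<lambda>\<tau>. pd2 (pd1 h) (\<tau>, v))) (at v within {0..1})"
      by - (rule has_field_derivative_transform_within[of _ _ _ _ 1], assumption, use t 0 in auto)
    have 2: "((\<lambda>b. h (a, b) - h (0, b)) has_field_derivative pd2 h (a, v) - pd2 h (0, v)) (at v within {0..1})"
      using t a by (intro derivative_intros has_pd2 h) (auto simp: mem_I2)
    have eq: "pd2 (\<lambda>p. h (a, snd p) - h (0, snd p)) (0, v) = d"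
      if "((\<lambda>b. h (a, b) - h (0, b)) has_real_derivative d) (at v within {0..1})" for d
      by (rule pd2_eq) (use that t in auto)
    have "integral (cbox 0 a) (\<lambda>\<tau>. pd2 (pd1 h) (\<tau>, v)) = pd2 h (a, v) - pd2 h (0, v)"
      using eq[OF 1] eq[OF 2] by simp
    then show ?thesis by simp
  qed
  have "continuous_on {0..1} (\<lambda>\<tau>. pd2 (pd1 h) (\<tau>, v))"
    using t by (intro continuous_on_compose2[OF cont] continuous_intros) (auto simp: mem_I2)
  from integral_has_real_derivative[OF this t(2)]
  have "((\<lambda>a. pd2 h (0, v) + integral {0..a} (\<lambda>\<tau>. pd2 (pd1 h) (\<tau>, v))) has_real_derivative
      pd2 (pd1 h) (u, v)) (at u within {0..1})"
    using DERIV_add[OF DERIV_const] by fastforce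
  then have "((\<lambda>a. pd2 h (a, v)) has_real_derivative pd2 (pd1 h) (u, v)) (at u within {0..1})"
    by (rule has_field_derivative_transform_within[of _ _ _ _ 1]) (use *[symmetric] t in auto)
  then show ?thesis using pd1_eq[of "pd2 h" v _ u] t by simp
qed

lemma integral_I2_left:
  fixes f :: "real \<times> real \<Rightarrow> real"
  assumes "continuous_on I2 f"
  shows "integral I2 f = integral {0..1} (\<lambda>v. integral {0..1} (\<lambda>u. f (u, v)))"
proof -
  have "integral I2 f = integral (cbox 0 1) (\<lambda>u. integral (cbox 0 1) (\<lambda>v. f (u, v)))"
    using assms integral_prod_continuous[of 0 0 1 1 f] by (simp add: I2_cbox)
  also have "\<dots> = integral (cbox 0 1) (\<lambda>v. integral (cbox 0 1) (\<lambda>u. f (u, v)))"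
    using assms by (intro integral_swap_continuous) (simp add: I2_cbox)
  finally show ?thesis by simp
qed

lemma integral_I2_right:
  fixes f :: "real \<times> real \<Rightarrow> real"
  assumes "continuous_on I2 f"
  shows "integral I2 f = integral {0..1} (\<lambda>u. integral {0..1} (\<lambda>v. f (u, v)))"
  using assms integral_prod_continuous[of 0 0 1 1 f] by (simp add: I2_cbox)

definition vanishes_on_edges :: "(real \<times> real \<Rightarrow> real) \<Rightarrow> bool" where
  "vanishes_on_edges h \<longleftrightarrow> (\<forall>\<tau>\<in>{0..1}. h (0, \<tau>) = 0 \<and> h (1, \<tau>) = 0 \<and> h (\<tau>, 0) = 0 \<and> h (\<tau>, 1) = 0)"

lemma integral_pd1_zero:
  assumes "smooth_on I2 h" "vanishes_on_edges h"
  shows "integral I2 (pd1 h) = 0"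
proof -
  have "((\<lambda>u. pd1 h (u, v)) has_integral h (1, v) - h (0, v)) {0..1}" if "v \<in> {0..1}" for v
    using that has_pd1[OF assms(1), of _ v]
    by (intro fundamental_theorem_of_calculus) (auto simp: mem_I2 has_real_derivative_iff_has_vector_derivative)
  then have *: "integral {0..1} (\<lambda>u. pd1 h (u, v)) = 0" if "v \<in> {0..1}" for v
    using that assms(2) by (auto simp: vanishes_on_edges_def intro!: integral_unique)
  have "integral {0..1} (\<lambda>v. integral {0..1} (\<lambda>u. pd1 h (u, v))) = integral {0..1} (\<lambda>_::real. 0::real)"
    by (rule integral_cong) (rule *)
  moreover have "continuous_on I2 (pd1 h)"
    by (intro smooth_on_imp_continuous_on smooth_on_pd1 assms)
  ultimately show ?thesis
    by (simp add: integral_I2_left)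
qed

lemma integral_pd2_zero:
  assumes "smooth_on I2 h" "vanishes_on_edges h"
  shows "integral I2 (pd2 h) = 0"
proof -
  have "((\<lambda>v. pd2 h (u, v)) has_integral h (u, 1) - h (u, 0)) {0..1}" if "u \<in> {0..1}" for u
    using that has_pd2[OF assms(1), of u]
    by (intro fundamental_theorem_of_calculus) (auto simp: mem_I2 has_real_derivative_iff_has_vector_derivative)
  then have *: "integral {0..1} (\<lambda>v. pd2 h (u, v)) = 0" if "u \<in> {0..1}" for u
    using that assms(2) by (auto simp: vanishes_on_edges_def intro!: integral_unique)
  have "integral {0..1} (\<lambda>u. integral {0..1} (\<lambda>v. pd2 h (u, v))) = integral {0..1} (\<lambda>_::real. 0::real)"
    by (rule integral_cong) (rule *)
  moreover have "continuous_on I2 (pd2 h)"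
    by (intro smooth_on_imp_continuous_on smooth_on_pd2 assms)
  ultimately show ?thesis
    by (simp add: integral_I2_right)
qed

definition edge_weight :: "real \<times> real \<Rightarrow> real" where
  "edge_weight = (\<lambda>(u, v). u * (1 - u) * (v * (1 - v)))"

lemma vanishes_on_edges_edge_weight: "vanishes_on_edges (\<lambda>t. edge_weight t * h t)"
  by (simp add: vanishes_on_edges_def edge_weight_def)

lemma smooth_on_edge_weight: "smooth_on S edge_weight"
proof -
  have "smooth_on S (\<lambda>t::real\<times>real. fst t * (1 - fst t) * (snd t * (1 - snd t)))"
    by (intro smooth_on_mult smooth_on_diff smooth_on_const smooth_on_fst smooth_on_snd)
  then show ?thesis by (simp add: edge_weight_def case_prod_beta')
qed

text \<open>This replaces the fundamental lemma of the calculus of variations. Variations have to vanish on the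
  edges only, not near them, so \<open>edge_weight * E\<close> is an admissible test function when \<open>E\<close> is
  smooth. The integrand is continuous and nonnegative, hence zero; this
  kills \<open>E\<close> inside the square, and continuity does the rest.\<close>

lemma edge_weighted_square_integral_zero:
  assumes E: "continuous_on I2 E" and int: "integral I2 (\<lambda>t. edge_weight t * E t * E t) = 0"
    and "t \<in> I2"
  shows "E t = 0"
proof -
  have ne: "box (0, 0) (1, 1::real) \<noteq> ({} :: (real \<times> real) set)"
    by (auto simp: box_ne_empty Basis_prod_def)
  have "edge_weight q * E q * E q = 0" if "q \<in> I2" for q
  proof -
    have "continuous_on I2 (\<lambda>t. edge_weight t * E t * E t)"
      by (intro continuous_intros E smooth_on_imp_continuous_on smooth_on_edge_weight)
    moreover have "edge_weight t * E t * E t \<ge> 0" if "t \<in> I2" for t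
      using that by (cases t) (auto simp: edge_weight_def mem_I2 mult.assoc intro!: mult_nonneg_nonneg)
    ultimately show ?thesis
      using integral_cbox_eq_0_iff[of "(0, 0)" "(1, 1)" "\<lambda>t. edge_weight t * E t * E t"] ne int that
      by (simp add: I2_cbox)
  qed
  then have "E q = 0" if "q \<in> box (0, 0) (1, 1)" for q
  proof -
    have "edge_weight q > 0" using that by (cases q) (auto simp: edge_weight_def mem_box Basis_prod_def)
    moreover have "q \<in> I2" using that box_subset_cbox I2_cbox by blast
    ultimately show ?thesis using \<open>\<And>q. q \<in> I2 \<Longrightarrow> edge_weight q * E q * E q = 0\<close>[of q] by simp
  qed
  moreover have "closure (box (0, 0) (1, 1 :: real)) = I2"
    using ne by (simp add: I2_cbox)
  ultimately show ?thesis
    using continuous_constant_on_closure[of "box (0, 0) (1, 1)" E 0 t] E assms(3) by simp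
qed

text \<open>Differentiation under the integral sign. What has to be known is joint continuity of the
  \<open>s\<close>-derivative, and this derivative is again smooth on \<open>T \<times> I2\<close>.\<close>

lemma has_real_derivative_integral_I2:
  assumes f: "smooth_on (T \<times> I2) f" and T: "open T" "convex T" "s0 \<in> T"
    and D: "\<And>t. t \<in> I2 \<Longrightarrow> ((\<lambda>s. f (s, t)) has_real_derivative D t) (at s0)"
  shows "((\<lambda>s. integral I2 (\<lambda>t. f (s, t))) has_real_derivative integral I2 D) (at s0)"
proof -
  have cont: "continuous_on (T \<times> I2) f" by (rule smooth_on_imp_continuous_on[OF f])
  have "((\<lambda>s. integral (cbox (0,0) (1,1)) (\<lambda>t. f (s, t))) has_real_derivative
      integral (cbox (0,0) (1,1)) (\<lambda>t. deriv (\<lambda>s. f (s, t)) s0)) (at s0 within T)"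
  proof (rule leibniz_rule_field_derivative)
    show "((\<lambda>s. f (s, t)) has_real_derivative deriv (\<lambda>s. f (s, t)) s) (at s within T)"
      if "s \<in> T" "t \<in> cbox (0, 0) (1, 1)" for s t
      using that smooth_on_slice_derivative(2)[OF f T(1)] by (simp add: I2_cbox has_field_derivative_at_within)
    show "(\<lambda>t. f (s, t)) integrable_on cbox (0, 0) (1, 1)" if "s \<in> T" for s
      using that by (intro integrable_continuous continuous_on_compose2[OF cont] continuous_intros)
        (auto simp: I2_cbox)
    show "continuous_on (T \<times> cbox (0, 0) (1, 1)) (\<lambda>(s, t). deriv (\<lambda>s. f (s, t)) s)"
      using smooth_on_imp_continuous_on[OF smooth_on_slice_derivative(1)[OF f T(1)]]
      by (simp add: I2_cbox)
  qed (use T in auto)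
  moreover have "integral I2 (\<lambda>t. deriv (\<lambda>s. f (s, t)) s0) = integral I2 D"
    using D by (intro integral_cong) (auto intro: DERIV_imp_deriv)
  ultimately show ?thesis using T by (simp add: at_within_open[of s0 T] I2_cbox)
qed

section \<open>The Euler-Lagrange equation in coordinates\<close>

lemma smooth_on_open_has_derivative:
  assumes "smooth_on \<Omega> F" "open \<Omega>" "p \<in> \<Omega>"
  shows "(F has_derivative frechet_derivative F (at p)) (at p)"
    and "smooth_extension \<Omega> F W g \<Longrightarrow> p \<in> W \<Longrightarrow> frechet_derivative F (at p) = frechet_derivative g (at p)"
proof -
  have *: "(F has_derivative frechet_derivative g (at p)) (at p)"
    if "smooth_extension \<Omega> F W g" "p \<in> W" for W g
    by (rule has_derivative_transform_within_open[OF smooth_extension_differentiable[OF that], of "\<Omega> \<inter> W"])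
       (use that assms in \<open>auto simp: smooth_extension_def\<close>)
  obtain V h where "p \<in> V" "smooth_extension \<Omega> F V h" by (rule smooth_onE[OF assms(1,3)])
  then show "(F has_derivative frechet_derivative F (at p)) (at p)"
    using * unfolding frechet_derivative_works[symmetric] differentiable_def by blast
  show "smooth_extension \<Omega> F W g \<Longrightarrow> p \<in> W \<Longrightarrow> frechet_derivative F (at p) = frechet_derivative g (at p)"
    using frechet_derivative_at[OF *] by simp
qed

lemma smooth_on_directional_derivative:
  assumes "smooth_on \<Omega> F" "open \<Omega>"
  shows "smooth_on \<Omega> (\<lambda>p. frechet_derivative F (at p) v)"
  by (rule smooth_on_partial[OF assms(1), where v=v])
     (simp add: smooth_on_open_has_derivative(2)[OF assms])

lemma linear_axis_expansion:
  fixes L :: "real ^ 'n \<Rightarrow> real"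
  assumes "linear L"
  shows "L d = (\<Sum>i\<in>UNIV. L (axis i 1) * d $ i)"
proof -
  have "L (\<Sum>i\<in>UNIV. d $ i *\<^sub>R axis i 1) = (\<Sum>i\<in>UNIV. L (axis i 1) * d $ i)"
    by (simp add: linear_sum[OF assms] linear_cmul[OF assms] mult.commute)
  then show ?thesis using basis_expansion[of d] by (simp add: scalar_mult_eq_scaleR)
qed

lemma chain_rule_line:
  fixes F :: "real ^ 'n \<Rightarrow> real"
  assumes "(F has_derivative F') (at (b \<tau>))"
    and "\<And>i. ((\<lambda>u. b u $ i) has_real_derivative d i) (at \<tau> within T)"
  shows "((\<lambda>u. F (b u)) has_real_derivative (\<Sum>i\<in>UNIV. F' (axis i 1) * d i)) (at \<tau> within T)"
proof -
  have "(b has_derivative (\<lambda>x. \<chi> i. d i * x)) (at \<tau> within T)"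
    using assms(2) unfolding has_field_derivative_def
    by (auto simp: has_derivative_componentwise_within[of b] Basis_vec_def inner_axis)
  from has_derivative_compose[OF this assms(1)]
  have "((\<lambda>u. F (b u)) has_derivative (\<lambda>x. F' (\<chi> i. d i * x))) (at \<tau> within T)" .
  moreover have "F' (\<chi> i. d i * x) = (\<Sum>i\<in>UNIV. F' (axis i 1) * d i) * x" for x
    using linear_axis_expansion[OF has_derivative_linear[OF assms(1)], of "\<chi> i. d i * x"]
    by (simp add: sum_distrib_right mult.assoc)
  ultimately show ?thesis by (simp add: has_field_derivative_def)
qed

lemma local_extremum_imp_deriv_zero:
  assumes "(F has_real_derivative d) (at s0)" "local_extremum F s0"
  shows "d = 0"
proof -
  obtain S where "open S" "s0 \<in> S" "(\<forall>s\<in>S. F s \<le> F s0) \<or> (\<forall>s\<in>S. F s0 \<le> F s)"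
    using assms(2) unfolding local_extremum_def eventually_nhds by blast
  then have "(\<lambda>v. d * v) = (\<lambda>v. 0)"
    using assms(1) differential_zero_maxmin[of s0 S F "\<lambda>v. d * v"] by (simp add: has_field_derivative_def)
  then show ?thesis by (metis mult.right_neutral)
qed

text \<open>The integrand of \<^const>\<open>J\<close> in a chart, for coefficients \<open>A\<close> and a square \<open>b\<close> in the image of the
  chart.\<close>

definition lagrangian ::
    "('n \<Rightarrow> 'n \<Rightarrow> real ^ 'n::finite \<Rightarrow> real) \<Rightarrow> (real \<times> real \<Rightarrow> real ^ 'n) \<Rightarrow> real \<times> real \<Rightarrow> real" where
  "lagrangian A b t =
     (\<Sum>i\<in>UNIV. \<Sum>j\<in>UNIV. A i j (b t) * (pd1 (\<lambda>t. b t $ i) t * pd2 (\<lambda>t. b t $ j) t))"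

locale coordinate_square =
  fixes \<Omega> :: "(real ^ 'n::finite) set"
    and A :: "'n \<Rightarrow> 'n \<Rightarrow> real ^ 'n \<Rightarrow> real"
    and c :: "real \<times> real \<Rightarrow> real ^ 'n"
  assumes open_domain: "open \<Omega>"
    and smooth_A: "\<And>i j. smooth_on \<Omega> (A i j)"
    and smooth_c: "smooth_on I2 c"
    and c_in: "\<And>t. t \<in> I2 \<Longrightarrow> c t \<in> \<Omega>"
begin

definition dA :: "'n \<Rightarrow> 'n \<Rightarrow> 'n \<Rightarrow> real \<times> real \<Rightarrow> real" where
  "dA k i j t = frechet_derivative (A i j) (at (c t)) (axis k 1)"

definition vel1 :: "'n \<Rightarrow> real \<times> real \<Rightarrow> real" where "vel1 i = pd1 (\<lambda>t. c t $ i)"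

definition vel2 :: "'n \<Rightarrow> real \<times> real \<Rightarrow> real" where "vel2 i = pd2 (\<lambda>t. c t $ i)"

text \<open>The derivatives of the integrand with respect to \<open>\<partial>c\<^sup>l/\<partial>t\<^sub>1\<close>, to \<open>\<partial>c\<^sup>l/\<partial>t\<^sub>2\<close> and to the
  position \<open>c\<^sup>l\<close>; hence \<open>euler l = 0\<close> is the Euler-Lagrange equation in the direction
  \<open>l\<close>.\<close>

definition momentum1 :: "'n \<Rightarrow> real \<times> real \<Rightarrow> real" where
  "momentum1 l t = (\<Sum>j\<in>UNIV. A l j (c t) * vel2 j t)"

definition momentum2 :: "'n \<Rightarrow> real \<times> real \<Rightarrow> real" where
  "momentum2 l t = (\<Sum>i\<in>UNIV. A i l (c t) * vel1 i t)"

definition force :: "'n \<Rightarrow> real \<times> real \<Rightarrow> real" where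
  "force l t = (\<Sum>i\<in>UNIV. \<Sum>j\<in>UNIV. dA l i j t * (vel1 i t * vel2 j t))"

definition euler :: "'n \<Rightarrow> real \<times> real \<Rightarrow> real" where
  "euler l t = pd1 (momentum1 l) t + pd2 (momentum2 l) t - force l t"

lemma smooth_component: "smooth_on I2 (\<lambda>t. c t $ i)"
  by (rule smooth_on_vec_nth[OF smooth_c])

lemma smooth_vel1: "smooth_on I2 (vel1 i)"
  unfolding vel1_def by (rule smooth_on_pd1[OF smooth_component])

lemma smooth_vel2: "smooth_on I2 (vel2 i)"
  unfolding vel2_def by (rule smooth_on_pd2[OF smooth_component])

lemma smooth_A_c: "smooth_on I2 (\<lambda>t. A i j (c t))"
  by (rule smooth_on_compose[OF smooth_A smooth_c]) (use c_in in auto)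

lemma smooth_dA: "smooth_on I2 (dA k i j)"
  unfolding dA_def
  by (rule smooth_on_compose[OF smooth_on_directional_derivative[OF smooth_A open_domain] smooth_c])
     (use c_in in auto)

lemma smooth_momentum1: "smooth_on I2 (momentum1 l)"
  unfolding momentum1_def
  by (intro smooth_on_sum smooth_on_mult smooth_A_c smooth_vel2) auto

lemma smooth_momentum2: "smooth_on I2 (momentum2 l)"
  unfolding momentum2_def by (intro smooth_on_sum smooth_on_mult smooth_A_c smooth_vel1) auto

lemma smooth_force: "smooth_on I2 (force l)"
  unfolding force_def by (intro smooth_on_sum smooth_on_mult smooth_dA smooth_vel1 smooth_vel2) auto

lemma smooth_euler: "smooth_on I2 (euler l)"
  unfolding euler_def
  by (intro smooth_on_add smooth_on_diff smooth_on_pd1 smooth_on_pd2 smooth_momentum1 smooth_momentum2 smooth_force)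

lemma A_c_derivative1:
  assumes "(u, v) \<in> I2"
  shows "((\<lambda>\<tau>. A i j (c (\<tau>, v))) has_real_derivative (\<Sum>k\<in>UNIV. dA k i j (u, v) * vel1 k (u, v)))
    (at u within {0..1})"
  unfolding dA_def vel1_def
  by (rule chain_rule_line[where b="\<lambda>\<tau>. c (\<tau>, v)"] smooth_on_open_has_derivative(1)[OF smooth_A open_domain]
      c_in[OF assms] has_pd1[OF smooth_component assms])+

lemma A_c_derivative2:
  assumes "(u, v) \<in> I2"
  shows "((\<lambda>\<tau>. A i j (c (u, \<tau>))) has_real_derivative (\<Sum>k\<in>UNIV. dA k i j (u, v) * vel2 k (u, v)))
    (at v within {0..1})"
  unfolding dA_def vel2_def
  by (rule chain_rule_line[where b="\<lambda>\<tau>. c (u, \<tau>)"] smooth_on_open_has_derivative(1)[OF smooth_A open_domain]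
      c_in[OF assms] has_pd2[OF smooth_component assms])+

text \<open>The chain rule for the coefficients produces the three groups of first-order terms. The second-order
  terms \<open>\<partial>\<^sub>1\<partial>\<^sub>2c\<^sup>j\<close> from \<open>momentum1\<close> and \<open>\<partial>\<^sub>2\<partial>\<^sub>1c\<^sup>j\<close> from \<open>momentum2\<close> can be collected since
  mixed partial derivatives commute.\<close>

lemma euler_eq:
  assumes "t \<in> I2"
  shows "euler l t =
    (\<Sum>i\<in>UNIV. \<Sum>j\<in>UNIV. (- dA l i j t + dA i l j t + dA j i l t) * vel1 i t * vel2 j t)
    + (\<Sum>j\<in>UNIV. (A l j (c t) + A j l (c t)) * pd1 (vel2 j) t)"
proof -
  obtain u v where t: "t = (u, v)" by (cases t)
  have uv: "u \<in> {0..1}" "v \<in> {0..1}" and I: "(u, v) \<in> I2" using assms t mem_I2 by auto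
  have "pd1 (momentum1 l) t = (\<Sum>j\<in>UNIV. A l j (c t) * pd1 (vel2 j) t
      + (\<Sum>k\<in>UNIV. dA k l j t * vel1 k t) * vel2 j t)"
    unfolding t momentum1_def
    by (intro pd1_eq uv DERIV_sum DERIV_mult' A_c_derivative1 I has_pd1 smooth_vel2)
  moreover have "pd2 (momentum2 l) t = (\<Sum>i\<in>UNIV. A i l (c t) * pd2 (vel1 i) t
      + (\<Sum>k\<in>UNIV. dA k i l t * vel2 k t) * vel1 i t)"
    unfolding t momentum2_def
    by (intro pd2_eq uv DERIV_sum DERIV_mult' A_c_derivative2 I has_pd2 smooth_vel1)
  moreover have "pd2 (vel1 i) t = pd1 (vel2 i) t" for i
    unfolding vel1_def vel2_def by (rule mixed_partials_commute[OF smooth_component assms, symmetric])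
  moreover have "(\<Sum>j\<in>UNIV. (\<Sum>k\<in>UNIV. dA k l j t * vel1 k t) * vel2 j t)
      = (\<Sum>i\<in>UNIV. \<Sum>j\<in>UNIV. dA i l j t * vel1 i t * vel2 j t)"
    by (subst sum.swap) (simp add: sum_distrib_right)
  moreover have "(\<Sum>i\<in>UNIV. (\<Sum>k\<in>UNIV. dA k i l t * vel2 k t) * vel1 i t)
      = (\<Sum>i\<in>UNIV. \<Sum>j\<in>UNIV. dA j i l t * vel1 i t * vel2 j t)"
    by (simp add: sum_distrib_left mult_ac)
  ultimately show ?thesis
    by (simp add: euler_def force_def sum.distrib sum_subtractf algebra_simps)
qed

text \<open>At \<open>s = 0\<close> the integrand has the derivative
  \<open>\<phi> * force l + pd1 \<phi> * momentum1 l + pd2 \<phi> * momentum2 l\<close>. This differs from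
  \<open>- \<phi> * euler l\<close> by the divergence of \<open>(\<phi> * momentum1 l, \<phi> * momentum2 l)\<close>, whose integral is zero
  because \<open>\<phi>\<close> vanishes on the edges.\<close>

lemma first_variation:
  assumes \<phi>: "smooth_on I2 \<phi>" "vanishes_on_edges \<phi>" and "\<epsilon> > 0"
    and in_\<Omega>: "\<And>s t. s \<in> {-\<epsilon><..<\<epsilon>} \<Longrightarrow> t \<in> I2 \<Longrightarrow> c t + (s * \<phi> t) *\<^sub>R axis l 1 \<in> \<Omega>"
  shows "((\<lambda>s. integral I2 (lagrangian A (\<lambda>t. c t + (s * \<phi> t) *\<^sub>R axis l 1)))
           has_real_derivative - integral I2 (\<lambda>t. \<phi> t * euler l t)) (at 0)"
    and "s \<in> {-\<epsilon><..<\<epsilon>} \<Longrightarrow> continuous_on I2 (lagrangian A (\<lambda>t. c t + (s * \<phi> t) *\<^sub>R axis l 1))"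
proof -
  let ?T = "{-\<epsilon><..<\<epsilon>}"
  let ?b = "\<lambda>s t. c t + (s * \<phi> t) *\<^sub>R axis l 1"
  \<comment> \<open>On the square \<open>L\<close> is the integrand, and unlike \<open>lagrangian\<close> it is visibly smooth in \<open>s\<close> and \<open>t\<close>.\<close>
  define \<delta> where "\<delta> i = (axis l 1 :: real ^ 'n) $ i" for i
  define L where "L p = (\<Sum>i\<in>UNIV. \<Sum>j\<in>UNIV. A i j (?b (fst p) (snd p)) *
      ((vel1 i (snd p) + fst p * (pd1 \<phi> (snd p) * \<delta> i)) *
       (vel2 j (snd p) + fst p * (pd2 \<phi> (snd p) * \<delta> j))))" for p
  have L: "lagrangian A (?b s) t = L (s, t)" if "t \<in> I2" for s t
  proof -
    obtain u v where t: "t = (u, v)" by (cases t)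
    have uv: "u \<in> {0..1}" "v \<in> {0..1}" and I: "(u, v) \<in> I2" using that t mem_I2 by auto
    have "pd1 (\<lambda>t. ?b s t $ i) t = vel1 i t + s * (pd1 \<phi> t * \<delta> i)" for i
      unfolding t \<delta>_def vel1_def using uv has_pd1[OF smooth_component I] has_pd1[OF \<phi>(1) I]
      by (intro pd1_eq) (auto intro!: derivative_eq_intros)
    moreover have "pd2 (\<lambda>t. ?b s t $ j) t = vel2 j t + s * (pd2 \<phi> t * \<delta> j)" for j
      unfolding t \<delta>_def vel2_def using uv has_pd2[OF smooth_component I] has_pd2[OF \<phi>(1) I]
      by (intro pd2_eq) (auto intro!: derivative_eq_intros)
    ultimately show ?thesis by (simp add: lagrangian_def L_def)
  qed
  have on_snd: "smooth_on (?T \<times> I2) (\<lambda>p. h (snd p))" if "smooth_on I2 h"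
    for h :: "real \<times> real \<Rightarrow> 'b::real_normed_vector"
    by (rule smooth_on_compose[OF that smooth_on_snd]) auto
  have sb: "smooth_on (?T \<times> I2) (\<lambda>p. ?b (fst p) (snd p))"
    by (intro smooth_on_add smooth_on_scaleR smooth_on_mult smooth_on_fst smooth_on_const on_snd smooth_c \<phi>)
  have "smooth_on (?T \<times> I2) (\<lambda>p. A i j (?b (fst p) (snd p)))" for i j
    by (rule smooth_on_compose[OF smooth_A sb]) (use in_\<Omega> in auto)
  then have smooth_L: "smooth_on (?T \<times> I2) L"
    unfolding L_def
    by (intro smooth_on_sum smooth_on_add smooth_on_mult smooth_on_fst smooth_on_const on_snd
        smooth_vel1 smooth_vel2 smooth_on_pd1 smooth_on_pd2 \<phi>) auto
  show "continuous_on I2 (lagrangian A (?b s))" if "s \<in> ?T"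
  proof -
    have "continuous_on I2 (\<lambda>t. L (s, t))"
      using that by (intro continuous_on_compose2[OF smooth_on_imp_continuous_on[OF smooth_L]] continuous_intros) auto
    then show ?thesis using L by (simp cong: continuous_on_cong)
  qed
  let ?D = "\<lambda>t. \<phi> t * force l t + pd1 \<phi> t * momentum1 l t + pd2 \<phi> t * momentum2 l t"
  have D: "((\<lambda>s. L (s, t)) has_real_derivative ?D t) (at 0)" if t: "t \<in> I2" for t
  proof -
    have "((\<lambda>s. A i j (?b s t)) has_real_derivative (\<Sum>k\<in>UNIV. dA k i j t * (\<phi> t * \<delta> k))) (at 0)" for i j
      unfolding dA_def
    proof (rule chain_rule_line[where b="\<lambda>s. ?b s t"])
      show "(A i j has_derivative frechet_derivative (A i j) (at (c t))) (at (c t + (0 * \<phi> t) *\<^sub>R axis l 1))"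
        using smooth_on_open_has_derivative(1)[OF smooth_A open_domain c_in[OF t]] by simp
    qed (auto simp: \<delta>_def intro!: derivative_eq_intros)
    moreover have "(\<Sum>k\<in>UNIV. dA k i j t * (\<phi> t * \<delta> k)) = dA l i j t * \<phi> t" for i j
      by (simp add: \<delta>_def axis_def if_distrib[of "\<lambda>x. _ * x"] cong: if_cong)
    ultimately have A': "((\<lambda>s. A i j (?b s t)) has_real_derivative dA l i j t * \<phi> t) (at 0)" for i j
      by simp
    have "((\<lambda>s. L (s, t)) has_real_derivative (\<Sum>i\<in>UNIV. \<Sum>j\<in>UNIV.
        dA l i j t * \<phi> t * (vel1 i t * vel2 j t) +
        A i j (c t) * (pd1 \<phi> t * \<delta> i * vel2 j t + vel1 i t * (pd2 \<phi> t * \<delta> j)))) (at 0)"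
      unfolding L_def fst_conv snd_conv
      by (intro DERIV_sum) (auto intro!: derivative_eq_intros A' simp: algebra_simps)
    also have "(\<Sum>i\<in>UNIV. \<Sum>j\<in>UNIV.
        dA l i j t * \<phi> t * (vel1 i t * vel2 j t) +
        A i j (c t) * (pd1 \<phi> t * \<delta> i * vel2 j t + vel1 i t * (pd2 \<phi> t * \<delta> j)))
      = \<phi> t * force l t + pd1 \<phi> t * (\<Sum>i\<in>UNIV. \<delta> i * (\<Sum>j\<in>UNIV. A i j (c t) * vel2 j t))
        + pd2 \<phi> t * (\<Sum>i\<in>UNIV. (\<Sum>j\<in>UNIV. \<delta> j * A i j (c t)) * vel1 i t)"
      by (simp add: force_def sum_distrib_left sum_distrib_right sum.distrib algebra_simps)
    also have "\<dots> = ?D t"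
      by (simp add: momentum1_def momentum2_def \<delta>_def axis_def if_distrib[of "\<lambda>x. x * _"] cong: if_cong)
    finally show ?thesis .
  qed
  have "integral I2 ?D = - integral I2 (\<lambda>t. \<phi> t * euler l t)"
  proof -
    let ?P = "\<lambda>t. \<phi> t * momentum1 l t" and ?Q = "\<lambda>t. \<phi> t * momentum2 l t"
    have P: "smooth_on I2 ?P" "vanishes_on_edges ?P" and Q: "smooth_on I2 ?Q" "vanishes_on_edges ?Q"
      using \<phi> by (auto intro!: smooth_on_mult smooth_momentum1 smooth_momentum2 simp: vanishes_on_edges_def)
    have int: "h integrable_on I2" if "smooth_on I2 h" for h :: "real \<times> real \<Rightarrow> real"
      unfolding I2_cbox using smooth_on_imp_continuous_on[OF that] by (intro integrable_continuous) (simp add: I2_cbox)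
    have "?D t = pd1 ?P t + pd2 ?Q t - \<phi> t * euler l t" if "t \<in> I2" for t
    proof -
      obtain u v where t: "t = (u, v)" by (cases t)
      have uv: "u \<in> {0..1}" "v \<in> {0..1}" and I: "(u, v) \<in> I2" using that t mem_I2 by auto
      have "pd1 ?P t = \<phi> t * pd1 (momentum1 l) t + pd1 \<phi> t * momentum1 l t"
        unfolding t by (intro pd1_eq uv DERIV_mult' has_pd1 \<phi> smooth_momentum1 I)
      moreover have "pd2 ?Q t = \<phi> t * pd2 (momentum2 l) t + pd2 \<phi> t * momentum2 l t"
        unfolding t by (intro pd2_eq uv DERIV_mult' has_pd2 \<phi> smooth_momentum2 I)
      ultimately show ?thesis by (simp add: euler_def algebra_simps)
    qed
    then have "integral I2 ?D = integral I2 (\<lambda>t. pd1 ?P t + pd2 ?Q t - \<phi> t * euler l t)"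
      by (rule integral_cong)
    also have "\<dots> = integral I2 (pd1 ?P) + integral I2 (pd2 ?Q) - integral I2 (\<lambda>t. \<phi> t * euler l t)"
      using P Q \<phi> by (simp add: integral_diff integral_add integrable_add int smooth_on_mult smooth_euler
          smooth_on_pd1 smooth_on_pd2)
    finally show ?thesis using integral_pd1_zero[OF P] integral_pd2_zero[OF Q] by simp
  qed
  moreover have "((\<lambda>s. integral I2 (\<lambda>t. L (s, t))) has_real_derivative integral I2 ?D) (at 0)"
    by (rule has_real_derivative_integral_I2[OF smooth_L _ _ _ D]) (use \<open>\<epsilon> > 0\<close> in auto)
  moreover have "integral I2 (\<lambda>t. L (s, t)) = integral I2 (lagrangian A (?b s))" for s
    by (rule integral_cong) (simp add: L)
  ultimately show "((\<lambda>s. integral I2 (lagrangian A (?b s)))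
     has_real_derivative - integral I2 (\<lambda>t. \<phi> t * euler l t)) (at 0)" by simp
qed

text \<open>The compact image of the square has a positive distance from the complement of the open set \<open>\<Omega>\<close>.\<close>

lemma small_variation_in_domain:
  assumes "continuous_on I2 \<phi>"
  obtains \<epsilon> where "\<epsilon> > 0"
    "\<And>s t. s \<in> {-\<epsilon><..<\<epsilon>} \<Longrightarrow> t \<in> I2 \<Longrightarrow> c t + (s * \<phi> t) *\<^sub>R axis l 1 \<in> \<Omega>"
proof -
  have "compact (c ` I2)"
    using smooth_on_imp_continuous_on[OF smooth_c] by (intro compact_continuous_image) (auto simp: I2_cbox)
  then obtain e where e: "e > 0" "(\<Union>x\<in>c ` I2. ball x e) \<subseteq> \<Omega>"
    using compact_subset_open_imp_ball_epsilon_subset[of "c ` I2" \<Omega>] open_domain c_in by blast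
  have "bounded (\<phi> ` I2)"
    using assms by (intro compact_imp_bounded compact_continuous_image) (auto simp: I2_cbox)
  then obtain B where B: "B > 0" "\<And>t. t \<in> I2 \<Longrightarrow> \<bar>\<phi> t\<bar> \<le> B"
    unfolding bounded_pos by auto
  show thesis
  proof
    show "e / B > 0" using e B by simp
    fix s t assume s: "s \<in> {- (e / B)<..<e / B}" and t: "t \<in> I2"
    have "\<bar>s * \<phi> t\<bar> \<le> \<bar>s\<bar> * B" using B(2)[OF t] by (simp add: abs_mult mult_left_mono)
    also have "\<dots> < e / B * B" using s B(1) by (intro mult_strict_right_mono) auto
    finally have "c t + (s * \<phi> t) *\<^sub>R axis l 1 \<in> ball (c t) e" using B(1) by (simp add: dist_norm)
    then show "c t + (s * \<phi> t) *\<^sub>R axis l 1 \<in> \<Omega>" using e(2) t by blast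
  qed
qed

lemma extremal_imp_euler_zero:
  assumes extreme: "\<And>\<phi> \<epsilon>. \<epsilon> > 0 \<Longrightarrow> smooth_on I2 \<phi> \<Longrightarrow> vanishes_on_edges \<phi> \<Longrightarrow>
      (\<And>s t. s \<in> {-\<epsilon><..<\<epsilon>} \<Longrightarrow> t \<in> I2 \<Longrightarrow> c t + (s * \<phi> t) *\<^sub>R axis l 1 \<in> \<Omega>) \<Longrightarrow>
      local_extremum (\<lambda>s. integral {0..1} (\<lambda>v. integral {0..1} (\<lambda>u.
        lagrangian A (\<lambda>t. c t + (s * \<phi> t) *\<^sub>R axis l 1) (u, v)))) 0"
    and "t \<in> I2"
  shows "euler l t = 0"
proof (rule edge_weighted_square_integral_zero[OF smooth_on_imp_continuous_on[OF smooth_euler] _ assms(2)])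
  \<comment> \<open>With this \<open>\<phi>\<close> the first variation is minus the weighted integral of the square of \<open>euler l\<close>.\<close>
  define \<phi> where "\<phi> t = edge_weight t * euler l t" for t
  have \<phi>: "smooth_on I2 \<phi>" "vanishes_on_edges \<phi>"
    unfolding \<phi>_def by (intro smooth_on_mult smooth_on_edge_weight smooth_euler vanishes_on_edges_edge_weight)+
  obtain \<epsilon> where \<epsilon>: "\<epsilon> > 0"
    "\<And>s t. s \<in> {-\<epsilon><..<\<epsilon>} \<Longrightarrow> t \<in> I2 \<Longrightarrow> c t + (s * \<phi> t) *\<^sub>R axis l 1 \<in> \<Omega>"
    using small_variation_in_domain[OF smooth_on_imp_continuous_on[OF \<phi>(1)]] by blast
  define F where "F s = integral I2 (lagrangian A (\<lambda>t. c t + (s * \<phi> t) *\<^sub>R axis l 1))" for s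
  define G where "G s = integral {0..1} (\<lambda>v. integral {0..1} (\<lambda>u.
        lagrangian A (\<lambda>t. c t + (s * \<phi> t) *\<^sub>R axis l 1) (u, v)))" for s
  have FG: "F s = G s" if "s \<in> {-\<epsilon><..<\<epsilon>}" for s
    unfolding F_def G_def by (rule integral_I2_left[OF first_variation(2)[OF \<phi> \<epsilon> that]])
  have "(F has_real_derivative - integral I2 (\<lambda>t. \<phi> t * euler l t)) (at 0)"
    unfolding F_def by (rule first_variation(1)[OF \<phi> \<epsilon>])
  then have "(G has_real_derivative - integral I2 (\<lambda>t. \<phi> t * euler l t)) (at 0)"
    by (rule has_field_derivative_transform_within_open[of _ _ _ "{-\<epsilon><..<\<epsilon>}"]) (use FG \<epsilon>(1) in auto)
  moreover have "local_extremum G 0" unfolding G_def by (rule extreme[OF \<epsilon>(1) \<phi> \<epsilon>(2)])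
  ultimately have "- integral I2 (\<lambda>t. \<phi> t * euler l t) = 0" by (rule local_extremum_imp_deriv_zero)
  then show "integral I2 (\<lambda>t. edge_weight t * euler l t * euler l t) = 0" by (simp add: \<phi>_def)
qed

end

lemma pd1_cong:
  assumes "smooth_on I2 h" "\<And>t. t \<in> I2 \<Longrightarrow> h t = k t" "t \<in> I2"
  shows "pd1 h t = pd1 k t"
proof -
  obtain u v where t: "t = (u, v)" by (cases t)
  have uv: "u \<in> {0..1}" "v \<in> {0..1}" using assms(3) t mem_I2 by auto
  have "((\<lambda>\<tau>. k (\<tau>, v)) has_real_derivative pd1 h (u, v)) (at u within {0..1})"
    by (rule has_field_derivative_transform_within[OF has_pd1[OF assms(1), of u v], of 1])
       (use uv assms(2) in \<open>auto simp: mem_I2\<close>)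
  from pd1_eq[OF this uv(1)] show ?thesis by (simp add: t)
qed

lemma pd2_cong:
  assumes "smooth_on I2 h" "\<And>t. t \<in> I2 \<Longrightarrow> h t = k t" "t \<in> I2"
  shows "pd2 h t = pd2 k t"
proof -
  obtain u v where t: "t = (u, v)" by (cases t)
  have uv: "u \<in> {0..1}" "v \<in> {0..1}" using assms(3) t mem_I2 by auto
  have "((\<lambda>\<tau>. k (u, \<tau>)) has_real_derivative pd2 h (u, v)) (at v within {0..1})"
    by (rule has_field_derivative_transform_within[OF has_pd2[OF assms(1), of u v], of 1])
       (use uv assms(2) in \<open>auto simp: mem_I2\<close>)
  from pd2_eq[OF this uv(2)] show ?thesis by (simp add: t)
qed

lemma lagrangian_cong:
  assumes "smooth_on I2 b" "\<And>t. t \<in> I2 \<Longrightarrow> b t = b' t" "t \<in> I2"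
  shows "lagrangian A b t = lagrangian A b' t"
proof -
  have "pd1 (\<lambda>t. b t $ i) t = pd1 (\<lambda>t. b' t $ i) t" "pd2 (\<lambda>t. b t $ i) t = pd2 (\<lambda>t. b' t $ i) t" for i
    using assms by (auto intro!: pd1_cong pd2_cong smooth_on_vec_nth)
  then show ?thesis using assms(2,3) by (simp add: lagrangian_def)
qed

lemma local_extremum_cong:
  assumes "local_extremum F s0" "open S" "s0 \<in> S" "\<And>s. s \<in> S \<Longrightarrow> F s = G s"
  shows "local_extremum G s0"
proof -
  have ev: "\<forall>\<^sub>F s in nhds s0. F s = G s" using assms(2-4) unfolding eventually_nhds by blast
  have "F s0 = G s0" using assms(3,4) by blast
  then show ?thesis
    using assms(1) eventually_subst[OF eventually_mono[OF ev, of "\<lambda>s. (F s \<le> F s0) = (G s \<le> G s0)"]]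
      eventually_subst[OF eventually_mono[OF ev, of "\<lambda>s. (F s \<ge> F s0) = (G s \<ge> G s0)"]]
    unfolding local_extremum_def by auto
qed

section \<open>Charts and velocity vectors\<close>

lemma smooth_near_linear_combination:
  assumes "smooth_near M p f" "smooth_near M p g"
  shows "smooth_near M p (\<lambda>q. c * f q + d * g q)"
proof -
  obtain W V where W: "openin (mtop M) W" "p \<in> W" "smooth_fun_on M W f"
    and V: "openin (mtop M) V" "p \<in> V" "smooth_fun_on M V g"
    using assms unfolding smooth_near_def by blast
  have "smooth_fun_on M (W \<inter> V) (\<lambda>q. c * f q + d * g q)"
    unfolding smooth_fun_on_def
  proof (clarify, unfold o_def)
    fix y X assume "(y, X) \<in> charts M"
    then have "smooth_on (y ` (W \<inter> X)) (\<lambda>z. f (inv_into X y z))" "smooth_on (y ` (V \<inter> X)) (\<lambda>z. g (inv_into X y z))"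
      using W V unfolding smooth_fun_on_def by (auto simp: o_def)
    then show "smooth_on (y ` (W \<inter> V \<inter> X)) (\<lambda>z. c * f (inv_into X y z) + d * g (inv_into X y z))"
      by (intro smooth_on_add smooth_on_mult smooth_on_const) (auto elim!: smooth_on_subset)
  qed
  then show ?thesis unfolding smooth_near_def using W V by blast
qed

lemma smooth_near_mult:
  assumes "smooth_near M p f" "smooth_near M p g"
  shows "smooth_near M p (\<lambda>q. f q * g q)"
proof -
  obtain W V where W: "openin (mtop M) W" "p \<in> W" "smooth_fun_on M W f"
    and V: "openin (mtop M) V" "p \<in> V" "smooth_fun_on M V g"
    using assms unfolding smooth_near_def by blast
  have "smooth_fun_on M (W \<inter> V) (\<lambda>q. f q * g q)"
    unfolding smooth_fun_on_def
  proof (clarify, unfold o_def)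
    fix y X assume "(y, X) \<in> charts M"
    then have "smooth_on (y ` (W \<inter> X)) (\<lambda>z. f (inv_into X y z))" "smooth_on (y ` (V \<inter> X)) (\<lambda>z. g (inv_into X y z))"
      using W V unfolding smooth_fun_on_def by (auto simp: o_def)
    then show "smooth_on (y ` (W \<inter> V \<inter> X)) (\<lambda>z. f (inv_into X y z) * g (inv_into X y z))"
      by (intro smooth_on_mult) (auto elim!: smooth_on_subset)
  qed
  then show ?thesis unfolding smooth_near_def using W V by blast
qed

locale manifold_chart =
  fixes M :: "('m, 'n::finite) manifold" and x :: "'m \<Rightarrow> real ^ 'n" and U :: "'m set"
  assumes manifold: "smooth_manifold M" and chart: "(x, U) \<in> charts M"
begin

lemma topological: "topological_chart (mtop M) (x, U)"
  using manifold chart unfolding smooth_manifold_def by blast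

lemma openin_chart: "openin (mtop M) U" and open_image_chart: "open (x ` U)"
  using topological by (auto simp: topological_chart_def)

lemma homeomorphic_chart: "homeomorphic_map (subtopology (mtop M) U) (top_of_set (x ` U)) x"
  using topological by (auto simp: topological_chart_def)

lemma inj_chart: "inj_on x U"
proof -
  have "topspace (subtopology (mtop M) U) = U" using openin_subset[OF openin_chart] by auto
  then show ?thesis using homeomorphic_imp_injective_map[OF homeomorphic_chart] by simp
qed

lemma inv_chart: "p \<in> U \<Longrightarrow> inv_into U x (x p) = p"
  using inj_chart by simp

lemma open_image:
  assumes "openin (mtop M) W"
  shows "open (x ` (W \<inter> U))"
proof -
  have "openin (subtopology (mtop M) U) (W \<inter> U)" using assms by (rule openin_subtopology_Int)
  then have "openin (top_of_set (x ` U)) (x ` (W \<inter> U))"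
    using homeomorphic_imp_open_map[OF homeomorphic_chart] unfolding open_map_def by blast
  then show ?thesis using open_image_chart openin_open_trans by blast
qed

lemma smooth_fun_on_chart_repr:
  "smooth_fun_on M W f \<Longrightarrow> smooth_on (x ` (W \<inter> U)) (\<lambda>z. f (inv_into U x z))"
  using chart unfolding smooth_fun_on_def by (auto simp: o_def)

lemma smooth_on_chart_change:
  assumes "(y, V) \<in> charts M"
  shows "smooth_on (y ` (U \<inter> V)) (\<lambda>z. x (inv_into V y z))"
proof -
  have "compatible (x, U) (y, V)" using manifold chart assms unfolding smooth_manifold_def by blast
  then show ?thesis by (simp add: compatible_def o_def)
qed

lemma smooth_near_coordinate:
  assumes "p \<in> U"
  shows "smooth_near M p (\<lambda>q. x q $ i)"
proof -
  have "smooth_fun_on M U (\<lambda>q. x q $ i)"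
    unfolding smooth_fun_on_def
    by (clarify, unfold o_def) (intro smooth_on_vec_nth smooth_on_chart_change)
  then show ?thesis unfolding smooth_near_def using assms openin_chart by blast
qed

text \<open>Smoothness into the manifold may be witnessed by a different chart near each point; the transition maps
  transport it to the chart \<open>x\<close>.\<close>

lemma smooth_map_into_imp_smooth_on:
  assumes "smooth_map_into M S g" "g ` S \<subseteq> U"
  shows "smooth_on S (\<lambda>t. x (g t))"
proof (rule smooth_on_local)
  fix p assume "p \<in> S"
  then obtain y V W where y: "(y, V) \<in> charts M" and W: "open W" "p \<in> W" "g ` (S \<inter> W) \<subseteq> V"
    and g: "smooth_on (S \<inter> W) (y \<circ> g)"
    using assms(1) unfolding smooth_map_into_def by blast
  interpret y: manifold_chart M y V by unfold_locales (rule manifold y)+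
  have "smooth_on (S \<inter> W) (\<lambda>t. x (inv_into V y ((y \<circ> g) t)))"
    by (rule smooth_on_compose[OF smooth_on_chart_change[OF y] g]) (use W assms(2) in auto)
  then have "smooth_on (S \<inter> W) (\<lambda>t. x (g t))"
    by (rule smooth_on_cong) (use W y.inv_chart in auto)
  then show "\<exists>W. open W \<and> p \<in> W \<and> smooth_on (S \<inter> W) (\<lambda>t. x (g t))" using W by blast
qed

lemma smooth_on_imp_smooth_map_into:
  assumes "smooth_on S (\<lambda>t. x (g t))" "g ` S \<subseteq> U"
  shows "smooth_map_into M S g"
  unfolding smooth_map_into_def
proof
  fix p assume "p \<in> S"
  show "\<exists>(y, V)\<in>charts M. \<exists>W. open W \<and> p \<in> W \<and> g ` (S \<inter> W) \<subseteq> V \<and> smooth_on (S \<inter> W) (y \<circ> g)"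
    using assms by (intro bexI[OF _ chart]) (auto intro!: exI[of _ UNIV] simp: o_def)
qed

end

locale square_in_chart = manifold_chart M x U
  for M :: "('m, 'n::finite) manifold" and x :: "'m \<Rightarrow> real ^ 'n" and U :: "'m set" +
  fixes \<beta> :: "real \<times> real \<Rightarrow> 'm"
  assumes smooth_\<beta>: "smooth_on I2 (\<lambda>t. x (\<beta> t))" and \<beta>_in: "\<And>t. t \<in> I2 \<Longrightarrow> \<beta> t \<in> U"
begin

text \<open>Continuity of \<open>\<beta>\<close> for the topology of the manifold. It is what makes the velocities of \<open>\<beta>\<close> depend on germs
  only.\<close>

lemma open_preimage:
  assumes "openin (mtop M) W" "t \<in> I2" "\<beta> t \<in> W"
  obtains V where "open V" "t \<in> V" "\<And>q. q \<in> I2 \<inter> V \<Longrightarrow> \<beta> q \<in> W"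
proof -
  have "openin (top_of_set I2) (I2 \<inter> (\<lambda>t. x (\<beta> t)) -` (x ` (W \<inter> U)))"
    using smooth_on_imp_continuous_on[OF smooth_\<beta>] open_image[OF assms(1)]
    by (rule continuous_openin_preimage_gen)
  then obtain V where V: "open V" "I2 \<inter> (\<lambda>t. x (\<beta> t)) -` (x ` (W \<inter> U)) = I2 \<inter> V"
    unfolding openin_open by blast
  have *: "\<beta> q \<in> W \<longleftrightarrow> q \<in> V" if "q \<in> I2" for q
  proof -
    have "x (\<beta> q) \<in> x ` (W \<inter> U) \<longleftrightarrow> \<beta> q \<in> W"
      using inj_on_image_mem_iff[OF inj_chart \<beta>_in[OF that], of "W \<inter> U"] \<beta>_in[OF that] by auto
    then show ?thesis using V(2) that by blast
  qed
  show thesis by (rule that[of V]) (use V * assms in auto)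
qed

text \<open>A function that is smooth near \<open>\<beta> t\<close> pulls back to a function on the square that has a smooth extension
  near \<open>t\<close>, so the derivatives in \<^const>\<open>velocity1\<close> and \<^const>\<open>velocity2\<close> exist, also at the edges.\<close>

lemma extension_along:
  assumes "smooth_near M (\<beta> t) f" "t \<in> I2"
  obtains W g where "t \<in> W" "smooth_extension I2 (\<lambda>t. f (\<beta> t)) W g"
proof -
  obtain X where X: "openin (mtop M) X" "\<beta> t \<in> X" "smooth_fun_on M X f"
    using assms(1) unfolding smooth_near_def by blast
  obtain V where V: "open V" "t \<in> V" "\<And>q. q \<in> I2 \<inter> V \<Longrightarrow> \<beta> q \<in> X"
    using open_preimage[OF X(1) assms(2) X(2)] by blast
  have "smooth_on (I2 \<inter> V) (\<lambda>t. f (inv_into U x (x (\<beta> t))))"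
    by (rule smooth_on_compose[OF smooth_fun_on_chart_repr[OF X(3)] smooth_on_subset[OF smooth_\<beta>]])
       (use V \<beta>_in in auto)
  then have "smooth_on (I2 \<inter> V) (\<lambda>t. f (\<beta> t))"
    by (rule smooth_on_cong) (use inv_chart \<beta>_in in auto)
  then obtain W g where W: "t \<in> W" "smooth_extension (I2 \<inter> V) (\<lambda>t. f (\<beta> t)) W g"
    using V assms(2) by (blast elim: smooth_onE)
  have "smooth_extension I2 (\<lambda>t. f (\<beta> t)) (W \<inter> V) g"
    using W(2) V(1) times_differentiable_on_subset[of _ W g "W \<inter> V"] unfolding smooth_extension_def by auto
  then show thesis using that W V by blast
qed

lemma has_velocity1:
  assumes "smooth_near M (\<beta> t) f" "t \<in> I2"
  shows "((\<lambda>\<tau>. f (\<beta> (\<tau>, snd t))) has_real_derivative velocity1 M \<beta> t f) (at (fst t) within {0..1})"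
proof -
  obtain u v where t: "t = (u, v)" by (cases t)
  obtain W g where "t \<in> W" "smooth_extension I2 (\<lambda>t. f (\<beta> t)) W g" by (rule extension_along[OF assms])
  from smooth_extension_pd1[OF this(2), of u v] this(1)
  have *: "((\<lambda>\<tau>. f (\<beta> (\<tau>, v))) has_real_derivative frechet_derivative g (at (u, v)) (1, 0)) (at u within {0..1})"
    using assms(2) t by simp
  from pd1_eq[of "f \<circ> \<beta>" v _ u] this have "pd1 (f \<circ> \<beta>) (u, v) = frechet_derivative g (at (u, v)) (1, 0)"
    using assms(2) t mem_I2 by simp
  then show ?thesis using * assms t by (simp add: velocity1_def)
qed

lemma has_velocity2:
  assumes "smooth_near M (\<beta> t) f" "t \<in> I2"
  shows "((\<lambda>\<tau>. f (\<beta> (fst t, \<tau>))) has_real_derivative velocity2 M \<beta> t f) (at (snd t) within {0..1})"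
proof -
  obtain u v where t: "t = (u, v)" by (cases t)
  obtain W g where "t \<in> W" "smooth_extension I2 (\<lambda>t. f (\<beta> t)) W g" by (rule extension_along[OF assms])
  from smooth_extension_pd2[OF this(2), of u v] this(1)
  have *: "((\<lambda>\<tau>. f (\<beta> (u, \<tau>))) has_real_derivative frechet_derivative g (at (u, v)) (0, 1)) (at v within {0..1})"
    using assms(2) t by simp
  from pd2_eq[of "f \<circ> \<beta>" u _ v] this have "pd2 (f \<circ> \<beta>) (u, v) = frechet_derivative g (at (u, v)) (0, 1)"
    using assms(2) t mem_I2 by simp
  then show ?thesis using * assms t by (simp add: velocity2_def)
qed

lemma velocity1_eq:
  assumes "smooth_near M (\<beta> t) f" "t \<in> I2"
    "((\<lambda>\<tau>. f (\<beta> (\<tau>, snd t))) has_real_derivative d) (at (fst t) within {0..1})"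
  shows "velocity1 M \<beta> t f = d"
  using pd1_eq[of "f \<circ> \<beta>" "snd t" d "fst t"] assms by (cases t) (simp add: velocity1_def mem_I2)

lemma velocity2_eq:
  assumes "smooth_near M (\<beta> t) f" "t \<in> I2"
    "((\<lambda>\<tau>. f (\<beta> (fst t, \<tau>))) has_real_derivative d) (at (snd t) within {0..1})"
  shows "velocity2 M \<beta> t f = d"
  using pd2_eq[of "f \<circ> \<beta>" "fst t" d "snd t"] assms by (cases t) (simp add: velocity2_def mem_I2)

text \<open>The common part of the two velocities: differentiation along a line through \<open>t\<close> obeys the sum and product rules and sees a function only near \<open>\<beta> t\<close>. The hypotheses on \<open>v\<close> say that it is
  this derivative on functions smooth near \<open>\<beta> t\<close>, and \<open>0\<close> on the others.\<close>

lemma derivation_along_line: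
  assumes t: "t \<in> I2" and l: "r \<in> {0..1}" "l ` {0..1} \<subseteq> I2" "l r = t" "continuous_on {0..1} l"
    and v: "\<And>f. \<not> smooth_near M (\<beta> t) f \<Longrightarrow> v f = 0"
    and has: "\<And>f. smooth_near M (\<beta> t) f \<Longrightarrow>
      ((\<lambda>\<tau>. f (\<beta> (l \<tau>))) has_real_derivative v f) (at r within {0..1})"
    and eq: "\<And>f d. smooth_near M (\<beta> t) f \<Longrightarrow>
      ((\<lambda>\<tau>. f (\<beta> (l \<tau>))) has_real_derivative d) (at r within {0..1}) \<Longrightarrow> v f = d"
  shows "v \<in> tangent_space M (\<beta> t)"
  unfolding tangent_space_def mem_Collect_eq
proof (intro conjI allI impI)
  show "v f = 0" if "\<not> smooth_near M (\<beta> t) f" for f by (rule v[OF that])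
  fix f g assume "smooth_near M (\<beta> t) f \<and> smooth_near M (\<beta> t) g"
  then have f: "smooth_near M (\<beta> t) f" and g: "smooth_near M (\<beta> t) g" by auto
  show "v (\<lambda>q. c * f q + d * g q) = c * v f + d * v g" for c d
    by (intro eq smooth_near_linear_combination f g DERIV_add DERIV_cmult has)
  show "v (\<lambda>q. f q * g q) = v f * g (\<beta> t) + f (\<beta> t) * v g"
    using DERIV_mult'[OF has[OF f] has[OF g]] l(3)
    by (intro eq smooth_near_mult f g) (simp add: algebra_simps)
  assume "\<exists>W. openin (mtop M) W \<and> \<beta> t \<in> W \<and> (\<forall>q\<in>W. f q = g q)"
  then obtain W where W: "openin (mtop M) W" "\<beta> t \<in> W" "\<And>q. q \<in> W \<Longrightarrow> f q = g q" by blast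
  obtain V where V: "open V" "t \<in> V" "\<And>q. q \<in> I2 \<inter> V \<Longrightarrow> \<beta> q \<in> W"
    using open_preimage[OF W(1) t W(2)] by blast
  have "(l \<longlongrightarrow> t) (at r within {0..1})" using l by (auto simp: continuous_on_def)
  then have "\<forall>\<^sub>F \<tau> in at r within {0..1}. l \<tau> \<in> V" using V(1,2) by (rule topological_tendstoD)
  moreover have "\<forall>\<^sub>F \<tau> in at r within {0..1}. \<tau> \<in> {0..1}" by (simp add: eventually_at_filter)
  ultimately have "\<forall>\<^sub>F \<tau> in at r within {0..1}. g (\<beta> (l \<tau>)) = f (\<beta> (l \<tau>))"
  proof eventually_elim
    case (elim \<tau>)
    then have "l \<tau> \<in> I2 \<inter> V" using l(2) by auto
    then show ?case using W(3)[OF V(3)] by simp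
  qed
  moreover have "g (\<beta> (l r)) = f (\<beta> (l r))" using W(2,3) l(3) by auto
  ultimately have "((\<lambda>\<tau>. f (\<beta> (l \<tau>))) has_real_derivative v g) (at r within {0..1})"
    using has[OF g] l(1) unfolding has_field_derivative_def
    by (blast intro: has_derivative_transform_eventually)
  then show "v f = v g" by (rule eq[OF f])
qed

text \<open>The local expression of \<open>\<omega>\<close> describes its values on tangent vectors only. The velocities have to be
  recognized as such before it can be applied to the integrand of \<^const>\<open>J\<close>.\<close>

lemma velocity1_tangent:
  assumes t: "t \<in> I2"
  shows "velocity1 M \<beta> t \<in> tangent_space M (\<beta> t)"
proof (rule derivation_along_line[OF t, where l="\<lambda>\<tau>. (\<tau>, snd t)" and r="fst t"])
  show "velocity1 M \<beta> t f = 0" if "\<not> smooth_near M (\<beta> t) f" for f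
    using that by (simp add: velocity1_def)
qed (use t in \<open>auto simp: I2_def intro!: continuous_intros has_velocity1 velocity1_eq\<close>)

lemma velocity2_tangent:
  assumes t: "t \<in> I2"
  shows "velocity2 M \<beta> t \<in> tangent_space M (\<beta> t)"
proof (rule derivation_along_line[OF t, where l="\<lambda>\<tau>. (fst t, \<tau>)" and r="snd t"])
  show "velocity2 M \<beta> t f = 0" if "\<not> smooth_near M (\<beta> t) f" for f
    using that by (simp add: velocity2_def)
qed (use t in \<open>auto simp: I2_def intro!: continuous_intros has_velocity2 velocity2_eq\<close>)

lemma coord_form_velocity:
  assumes "t \<in> I2"
  shows "coord_form x i (velocity1 M \<beta> t) = pd1 (\<lambda>t. x (\<beta> t) $ i) t"
    and "coord_form x i (velocity2 M \<beta> t) = pd2 (\<lambda>t. x (\<beta> t) $ i) t"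
  using smooth_near_coordinate[OF \<beta>_in[OF assms], of i]
  by (auto simp: coord_form_def velocity1_def velocity2_def o_def)

lemma J_eq_integral_lagrangian:
  assumes "local_expression M (x, U) \<omega> a"
  shows "J M \<omega> \<beta> = integral {0..1} (\<lambda>v. integral {0..1} (\<lambda>u.
    lagrangian (\<lambda>i j z. a i j (inv_into U x z)) (\<lambda>t. x (\<beta> t)) (u, v)))"
proof -
  have "\<omega> (\<beta> t) (velocity1 M \<beta> t) (velocity2 M \<beta> t) =
      lagrangian (\<lambda>i j z. a i j (inv_into U x z)) (\<lambda>t. x (\<beta> t)) t" if "t \<in> I2" for t
    using assms \<beta>_in[OF that] velocity1_tangent[OF that] velocity2_tangent[OF that]
    by (simp add: local_expression_def lagrangian_def inv_chart coord_form_velocity[OF that])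
  then show ?thesis unfolding J_def by (intro integral_cong) (auto simp: mem_I2)
qed

end



section \<open>Extremal squares in a manifold\<close>

theorem lemma3p1:
  fixes M :: "('m, 'n::finite) manifold"
    and x :: "'m \<Rightarrow> real ^ 'n"
    and U :: "'m set"
    and \<omega> :: "'m tensor2"
    and a :: "'n \<Rightarrow> 'n \<Rightarrow> 'm \<Rightarrow> real"
    and \<gamma> :: "real \<times> real \<Rightarrow> 'm"
  assumes manifold: "smooth_manifold M"
    and chart: "(x, U) \<in> charts M"
    and tensor: "two_tensor M \<omega>"
    and smooth_coeffs: "\<And>i j. smooth_fun_on M U (a i j)"
    and local_expr: "local_expression M (x, U) \<omega> a"
    and immersion: "immersion_of_square M \<gamma>"
    and into_U: "\<gamma> ` I2 \<subseteq> U"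
    and extreme: "\<And>\<epsilon> \<alpha>. variation M U \<gamma> \<epsilon> \<alpha> \<Longrightarrow> local_extremum (\<lambda>s. J M \<omega> (\<alpha> s)) 0"
  shows "\<forall>l. \<forall>t\<in>I2.
    (\<Sum>i\<in>UNIV. \<Sum>j\<in>UNIV.
       (- coord_vec M (x, U) l (\<gamma> t) (a i j)
        + coord_vec M (x, U) i (\<gamma> t) (a l j)
        + coord_vec M (x, U) j (\<gamma> t) (a i l))
       * pd1 (\<lambda>t. x (\<gamma> t) $ i) t * pd2 (\<lambda>t. x (\<gamma> t) $ j) t)
    + (\<Sum>j\<in>UNIV. (a l j (\<gamma> t) + a j l (\<gamma> t)) * pd1 (pd2 (\<lambda>t. x (\<gamma> t) $ j)) t) = 0"
proof (intro allI ballI)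
  fix l t assume t: "t \<in> I2"
  interpret manifold_chart M x U by unfold_locales (rule manifold chart)+
  define A where "A i j z = a i j (inv_into U x z)" for i j z
  define c where "c t = x (\<gamma> t)" for t
  have smooth_c: "smooth_on I2 c"
    unfolding c_def using immersion into_U
    by (intro smooth_map_into_imp_smooth_on) (auto simp: immersion_of_square_def)
  interpret coordinate_square "x ` U" A c
  proof
    show "smooth_on (x ` U) (A i j)" for i j
      using smooth_fun_on_chart_repr[OF smooth_coeffs] by (simp add: A_def[abs_def])
  qed (use open_image_chart smooth_c into_U in \<open>auto simp: c_def\<close>)
  have "euler l t = 0"
  proof (rule extremal_imp_euler_zero[OF _ t])
    fix \<phi> \<epsilon>
    assume \<epsilon>: "\<epsilon> > 0" and \<phi>: "smooth_on I2 \<phi>" "vanishes_on_edges \<phi>"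
      and in_image: "\<And>s t. s \<in> {-\<epsilon><..<\<epsilon>} \<Longrightarrow> t \<in> I2 \<Longrightarrow> c t + (s * \<phi> t) *\<^sub>R axis l 1 \<in> x ` U"
    \<comment> \<open>The variation in the chart; the inverse of the chart carries it back to the manifold.\<close>
    let ?b = "\<lambda>s t. c t + (s * \<phi> t) *\<^sub>R axis l 1"
    define \<alpha> where "\<alpha> s t = inv_into U x (?b s t)" for s t
    have \<alpha>: "x (\<alpha> s t) = ?b s t" "\<alpha> s t \<in> U" if "s \<in> {-\<epsilon><..<\<epsilon>}" "t \<in> I2" for s t
      using in_image[OF that] by (auto simp: \<alpha>_def f_inv_into_f inv_into_into)
    have fixed: "\<alpha> s t = \<gamma> t" if "s * \<phi> t = 0" "t \<in> I2" for s t
      using that into_U inv_chart by (auto simp: \<alpha>_def c_def)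
    have smooth_b: "smooth_on ({-\<epsilon><..<\<epsilon>} \<times> I2) (\<lambda>p. ?b (fst p) (snd p))"
      by (intro smooth_on_add smooth_on_scaleR smooth_on_mult smooth_on_fst smooth_on_const
          smooth_on_compose[OF smooth_c smooth_on_snd] smooth_on_compose[OF \<phi>(1) smooth_on_snd]) auto
    have "variation M U \<gamma> \<epsilon> \<alpha>"
      unfolding variation_def
    proof (intro conjI ballI \<epsilon>)
      have "smooth_on ({-\<epsilon><..<\<epsilon>} \<times> I2) (\<lambda>p. x (case p of (s, t) \<Rightarrow> \<alpha> s t))"
        by (rule smooth_on_cong[OF smooth_b]) (auto simp: \<alpha>)
      then show "smooth_map_into M ({-\<epsilon><..<\<epsilon>} \<times> I2) (\<lambda>(s, t). \<alpha> s t)"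
        by (rule smooth_on_imp_smooth_map_into) (auto intro: \<alpha>)
    qed (use \<phi>(2) in \<open>auto simp: vanishes_on_edges_def mem_I2 intro!: \<alpha> fixed\<close>)
    then have J_extremum: "local_extremum (\<lambda>s. J M \<omega> (\<alpha> s)) 0" by (rule extreme)
    have J_eq: "J M \<omega> (\<alpha> s) = integral {0..1} (\<lambda>v. integral {0..1} (\<lambda>u. lagrangian A (?b s) (u, v)))"
      if s: "s \<in> {-\<epsilon><..<\<epsilon>}" for s
    proof -
      have smooth_bs: "smooth_on I2 (?b s)"
        by (intro smooth_on_add smooth_on_scaleR smooth_on_mult smooth_on_const smooth_c \<phi>)
      have smooth_x\<alpha>: "smooth_on I2 (\<lambda>t. x (\<alpha> s t))"
        by (rule smooth_on_cong[OF smooth_bs]) (simp add: \<alpha>[OF s])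
      interpret square_in_chart M x U "\<alpha> s"
        by unfold_locales (use smooth_x\<alpha> \<alpha>[OF s] in auto)
      show ?thesis
        unfolding J_eq_integral_lagrangian[OF local_expr] A_def[symmetric, abs_def]
        by (intro integral_cong lagrangian_cong smooth_x\<alpha> \<alpha>[OF s]) (auto simp: mem_I2)
    qed
    show "local_extremum (\<lambda>s. integral {0..1} (\<lambda>v. integral {0..1} (\<lambda>u.
        lagrangian A (?b s) (u, v)))) 0"
      by (rule local_extremum_cong[OF J_extremum open_greaterThanLessThan[of "-\<epsilon>" \<epsilon>] _ J_eq]) (use \<epsilon> in auto)
  qed
  moreover have "coord_vec M (x, U) k (\<gamma> t) (a i j) = dA k i j t" for i j k
  proof -
    have "smooth_near M (\<gamma> t) (a i j)"
      unfolding smooth_near_def using smooth_coeffs openin_chart into_U t by blast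
    then show ?thesis unfolding dA_def by (simp add: coord_vec_def A_def[abs_def] c_def o_def)
  qed
  moreover have "A i j (c t) = a i j (\<gamma> t)" for i j
    using into_U t by (auto simp: A_def c_def inv_chart)
  ultimately show "(\<Sum>i\<in>UNIV. \<Sum>j\<in>UNIV.
       (- coord_vec M (x, U) l (\<gamma> t) (a i j)
        + coord_vec M (x, U) i (\<gamma> t) (a l j)
        + coord_vec M (x, U) j (\<gamma> t) (a i l))
       * pd1 (\<lambda>t. x (\<gamma> t) $ i) t * pd2 (\<lambda>t. x (\<gamma> t) $ j) t)
    + (\<Sum>j\<in>UNIV. (a l j (\<gamma> t) + a j l (\<gamma> t)) * pd1 (pd2 (\<lambda>t. x (\<gamma> t) $ j)) t) = 0"
    using euler_eq[OF t, of l] by (simp add: vel1_def vel2_def c_def)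
qed

end
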